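(* Let $n,k\geq 1$. If $X\subseteq\mathbb{N}$ is finite, $\omega^{kn+3}$-large and $\min X\geq 17$, then $X$ is $\mathsf{RT}^2_k$-$\omega^n$-large, i.e. for every coloring $f:[X]^2\to k=\{0,\dots,k-1\}$ there is an $\omega^n$-large set $H\subseteq X$ on whose pairs $f$ is constant.
   Context: Fundamental sequences for ordinals $\alpha<\epsilon_0$: $\{0\}(x)=0$; for $\alpha\neq0$ write $\alpha=\beta+\omega^\gamma$ in Cantor normal form with $\omega^\gamma$ the last term; then $\{\alpha\}(x)=\beta$ if $\gamma=0$, $\beta+\omega^{\gamma'}\cdot x$ if $\gamma=\gamma'+1$, $\beta+\omega^{\{\gamma\}(x)}$ if $\gamma$ is a limit. For finite $X=\{x_0<\dots<x_s\}$, $\{\alpha\}(X)=\{\cdots\{\{\alpha\}(x_0)\}(x_1)\cdots\}(x_s)$, and $X$ is $\alpha$-large iff $\{\alpha\}(X)=0$. $[X]^2$ denotes the set of two-element subsets of $X$. *)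

theory Defs
  imports "HOL-Library.Ramsey" "HOL-Library.FuncSet"
begin

text \<open>
  Ordinals below \<open>\<epsilon>\<^sub>0\<close> are represented by their hereditary Cantor normal forms:
  \<open>CNF [\<gamma>\<^sub>1, \<dots>, \<gamma>\<^sub>r]\<close> stands for \<open>\<omega>\<^bsup>\<gamma>\<^sub>1\<^esup> + \<dots> + \<omega>\<^bsup>\<gamma>\<^sub>r\<^esup>\<close>, where repetitions of an exponent encode
  the coefficients and the empty list is \<open>0\<close>. The terms that denote Cantor normal forms are those
  with hereditarily non-increasing exponents, i.e. those satisfying \<open>is_cnf\<close> below; on these,
  equality of terms is equality of ordinals and \<open>ord_less\<close> is the order of the ordinals.
\<close>

datatype ord_cnf = CNF (exponents: "ord_cnf list")

abbreviation ord_zero :: ord_cnf where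
  "ord_zero \<equiv> CNF []"

fun ord_less :: "ord_cnf \<Rightarrow> ord_cnf \<Rightarrow> bool" where
  "ord_less a (CNF []) \<longleftrightarrow> False"
| "ord_less (CNF []) (CNF (b # bs)) \<longleftrightarrow> True"
| "ord_less (CNF (a # as)) (CNF (b # bs)) \<longleftrightarrow>
     ord_less a b \<or> a = b \<and> ord_less (CNF as) (CNF bs)"

fun is_cnf :: "ord_cnf \<Rightarrow> bool" where
  "is_cnf (CNF as) \<longleftrightarrow>
     (\<forall>a\<in>set as. is_cnf a) \<and> sorted_wrt (\<lambda>a b. ord_less b a \<or> a = b) as"

definition ord_of_nat :: "nat \<Rightarrow> ord_cnf" where
  "ord_of_nat m = CNF (replicate m ord_zero)"

definition omega_pow :: "ord_cnf \<Rightarrow> ord_cnf" where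
  "omega_pow \<gamma> = CNF [\<gamma>]"

text \<open>
  In the normal form \<open>\<beta> + \<omega>\<^bsup>\<gamma>\<^esup>\<close> of \<open>CNF as\<close> with \<open>as \<noteq> []\<close>, \<open>\<gamma>\<close> is \<open>last as\<close> and \<open>\<beta>\<close> is
  \<open>CNF (butlast as)\<close>. A nonzero \<open>\<gamma>\<close> is a successor \<open>\<gamma>' + 1\<close> iff its own last term is \<open>\<omega>\<^bsup>0\<^esup>\<close>,
  and then \<open>\<gamma>'\<close> arises by dropping that term.
\<close>

function fundseq :: "ord_cnf \<Rightarrow> nat \<Rightarrow> ord_cnf" where
  "fundseq (CNF as) x =
     (if as = [] then ord_zero
      else let \<beta> = butlast as; \<gamma> = last as in
        if \<gamma> = ord_zero then CNF \<beta>
        else if last (exponents \<gamma>) = ord_zero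
        then CNF (\<beta> @ replicate x (CNF (butlast (exponents \<gamma>))))
        else CNF (\<beta> @ [fundseq \<gamma> x]))"
  by pat_completeness auto
termination
proof (relation "measure (size \<circ> fst)")
  fix as :: "ord_cnf list" and x :: nat and \<beta> \<gamma>
  assume "as \<noteq> []" "\<gamma> = last as"
  then have "size \<gamma> < Suc (size_list size as)"
    by (metis last_in_set less_Suc_eq_le order_refl size_list_estimation')
  then show "((\<gamma>, x), (CNF as, x)) \<in> measure (size \<circ> fst)"
    by simp
qed simp

declare fundseq.simps [simp del]

definition fundseq_set :: "ord_cnf \<Rightarrow> nat set \<Rightarrow> ord_cnf" where
  "fundseq_set \<alpha> X = fold (\<lambda>x \<beta>. fundseq \<beta> x) (sorted_list_of_set X) \<alpha>"

definition large :: "ord_cnf \<Rightarrow> nat set \<Rightarrow> bool" where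
  "large \<alpha> X \<longleftrightarrow> finite X \<and> fundseq_set \<alpha> X = ord_zero"

definition RT2_large :: "nat \<Rightarrow> ord_cnf \<Rightarrow> nat set \<Rightarrow> bool" where
  "RT2_large k \<alpha> X \<longleftrightarrow>
     (\<forall>f \<in> [X]\<^bsup>2\<^esup> \<rightarrow> {..<k}. \<exists>H \<subseteq> X. large \<alpha> H \<and> (\<exists>c. \<forall>e \<in> [H]\<^bsup>2\<^esup>. f e = c))"

text \<open>
  The order is a strict linear order, and fundamental sequences stay inside the normal forms and
  are strictly below the given nonzero ordinal.
\<close>

lemma ord_less_irrefl: "\<not> ord_less a a"
proof -
  have "ord_less a b \<Longrightarrow> a \<noteq> b" for a b
    by (induction a b rule: ord_less.induct) auto
  then show ?thesis by blast
qed

lemma ord_less_trans: "ord_less a b \<Longrightarrow> ord_less b c \<Longrightarrow> ord_less a c"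
proof (induction a b arbitrary: c rule: ord_less.induct)
  case (2 b bs)
  then show ?case by (cases "(CNF [], c)" rule: ord_less.cases) auto
next
  case (3 a as b bs)
  obtain c' cs where c: "c = CNF (c' # cs)"
    using 3 by (cases "(CNF (b # bs), c)" rule: ord_less.cases) auto
  show ?case using 3 unfolding c by auto
qed simp

lemma ord_less_linear: "ord_less a b \<or> a = b \<or> ord_less b a"
proof (induction a b rule: ord_less.induct)
  case (1 a)
  then show ?case by (cases a rule: ord_cnf.exhaust; case_tac x) auto
qed auto

lemma ord_less_append: "ord_less (CNF as) (CNF bs) \<Longrightarrow> ord_less (CNF (cs @ as)) (CNF (cs @ bs))"
  by (induction cs) auto

lemma ord_less_snoc: "ord_less (CNF as) (CNF (as @ [b]))"
  by (induction as) auto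

lemma is_cnf_append:
  "is_cnf (CNF (as @ bs)) \<longleftrightarrow> is_cnf (CNF as) \<and> is_cnf (CNF bs) \<and>
     (\<forall>a\<in>set as. \<forall>b\<in>set bs. ord_less b a \<or> a = b)"
  by (auto simp: sorted_wrt_append)

lemma fundseq_less_is_cnf:
  "is_cnf \<alpha> \<Longrightarrow> is_cnf (fundseq \<alpha> x) \<and> (\<alpha> \<noteq> ord_zero \<longrightarrow> ord_less (fundseq \<alpha> x) \<alpha>)"
proof (induction \<alpha> x rule: fundseq.induct)
  case (1 as x)
  show ?case
  proof (cases "as = []")
    case True
    then show ?thesis by (simp add: fundseq.simps)
  next
    case False
    define \<beta> \<gamma> where "\<beta> = butlast as" and "\<gamma> = last as"
    have as: "as = \<beta> @ [\<gamma>]" using False by (simp add: \<beta>_def \<gamma>_def)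
    have cnf: "is_cnf (CNF \<beta>)" "is_cnf \<gamma>" "\<forall>a\<in>set \<beta>. ord_less \<gamma> a \<or> a = \<gamma>"
      using "1.prems" unfolding as is_cnf_append by auto
    have step: "is_cnf (CNF (\<beta> @ replicate m \<delta>)) \<and> ord_less (CNF (\<beta> @ replicate m \<delta>)) (CNF as)"
      if "is_cnf \<delta>" "ord_less \<delta> \<gamma>" for m \<delta>
    proof
      have "sorted_wrt (\<lambda>a b. ord_less b a \<or> a = b) (replicate m \<delta>)"
        by (induction m) auto
      then have "is_cnf (CNF (replicate m \<delta>))" using that by simp
      then show "is_cnf (CNF (\<beta> @ replicate m \<delta>))"
        unfolding is_cnf_append using cnf that ord_less_trans by auto
      have "ord_less (CNF (replicate m \<delta>)) (CNF [\<gamma>])"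
        using that by (cases m) auto
      then show "ord_less (CNF (\<beta> @ replicate m \<delta>)) (CNF as)"
        unfolding as by (rule ord_less_append)
    qed
    consider (zero) "\<gamma> = ord_zero"
      | (succ) "\<gamma> \<noteq> ord_zero" "last (exponents \<gamma>) = ord_zero"
      | (limit) "\<gamma> \<noteq> ord_zero" "last (exponents \<gamma>) \<noteq> ord_zero" by blast
    then show ?thesis
    proof cases
      case zero
      then have "fundseq (CNF as) x = CNF \<beta>" by (simp add: as fundseq.simps)
      then show ?thesis using cnf(1) ord_less_snoc unfolding as by metis
    next
      case succ
      define \<delta> where "\<delta> = butlast (exponents \<gamma>)"
      have \<gamma>: "\<gamma> = CNF (\<delta> @ [ord_zero])"
        using succ unfolding \<delta>_def
        by (metis append_butlast_last_id ord_cnf.collapse)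
      have "fundseq (CNF as) x = CNF (\<beta> @ replicate x (CNF \<delta>))"
        using succ by (simp add: as fundseq.simps \<delta>_def)
      moreover have "is_cnf (CNF \<delta>)" using cnf(2) unfolding \<gamma> is_cnf_append by blast
      moreover have "ord_less (CNF \<delta>) \<gamma>" unfolding \<gamma> by (rule ord_less_snoc)
      ultimately show ?thesis using step by metis
    next
      case limit
      have "fundseq (CNF as) x = CNF (\<beta> @ replicate 1 (fundseq \<gamma> x))"
        using limit by (subst fundseq.simps) (simp add: as)
      moreover have "is_cnf (fundseq \<gamma> x) \<and> ord_less (fundseq \<gamma> x) \<gamma>"
        using "1.IH"[OF False \<beta>_def \<gamma>_def] limit cnf(2) by blast
      ultimately show ?thesis using step by metis
    qed
  qed
qed

end

theory Submission
  imports Defs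
begin

text \<open>
  Spending the factor \<open>\<omega>\<^sup>3\<close>, one passes to three successive \<open>\<omega>\<^bsup>k n\<^esup>\<close>-large blocks whose elements grow
  doubly exponentially and are at least \<open>k\<close>. On such a sparse set largeness survives partitions into
  few classes, so successive \<open>\<omega>\<^bsup>e+1\<^esup>\<close>-large blocks can be thinned to blocks that still contain many
  \<open>\<omega>\<^bsup>e\<^esup>\<close>-large ones and such that the colour of a pair of points from two different blocks depends
  only on the blocks. The finite Ramsey theorem gives many blocks with a single cross colour \<open>c\<close>.
  Hence it is enough to find, inside the blocks, either sets of colour \<open>c\<close> that are large for an
  exponent smaller by one, or a set of another colour that is already as large as desired. By
  induction on \<open>e = \<Sum>c<k. m c\<close>, every colouring of a sparse set with sufficiently many \<open>\<omega>\<^bsup>e\<^esup>\<close>-large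
  blocks has, for some colour \<open>c\<close>, a homogeneous set containing a prescribed number of
  \<open>\<omega>\<^bsup>m c\<^esup>\<close>-large blocks. The theorem is the case \<open>m c = n\<close>.
\<close>

subsection \<open>Successive blocks\<close>

definition less_sets :: "'a::ord set \<Rightarrow> 'a set \<Rightarrow> bool" (infix \<open>\<lless>\<close> 50) where
  "A \<lless> B \<longleftrightarrow> (\<forall>a\<in>A. \<forall>b\<in>B. a < b)"

definition sorted_family :: "('a \<Rightarrow> 'a \<Rightarrow> bool) \<Rightarrow> nat \<Rightarrow> (nat \<Rightarrow> 'a) \<Rightarrow> bool" where
  "sorted_family R N G \<longleftrightarrow> (\<forall>j<N. \<forall>i<j. R (G i) (G j))"

definition has_blocks :: "('a::ord set \<Rightarrow> bool) \<Rightarrow> nat \<Rightarrow> 'a set \<Rightarrow> bool" where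
  "has_blocks P c X \<longleftrightarrow> (\<exists>G. sorted_family (\<lless>) c G \<and> (\<forall>i<c. G i \<subseteq> X \<and> P (G i)))"

lemma less_setsI: "(\<And>a b. a \<in> A \<Longrightarrow> b \<in> B \<Longrightarrow> a < b) \<Longrightarrow> A \<lless> B"
  by (simp add: less_sets_def)

lemma less_setsD: "A \<lless> B \<Longrightarrow> a \<in> A \<Longrightarrow> b \<in> B \<Longrightarrow> a < b"
  by (simp add: less_sets_def)

lemma less_sets_mono: "A \<lless> B \<Longrightarrow> A' \<subseteq> A \<Longrightarrow> B' \<subseteq> B \<Longrightarrow> A' \<lless> B'"
  unfolding less_sets_def by blast

lemma sorted_familyI: "(\<And>i j. i < j \<Longrightarrow> j < N \<Longrightarrow> R (G i) (G j)) \<Longrightarrow> sorted_family R N G"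
  by (simp add: sorted_family_def)

lemma sorted_familyD: "sorted_family R N G \<Longrightarrow> i < j \<Longrightarrow> j < N \<Longrightarrow> R (G i) (G j)"
  by (simp add: sorted_family_def)

lemma has_blocksI:
  assumes "sorted_family (\<lless>) c G" "\<And>i. i < c \<Longrightarrow> G i \<subseteq> X" "\<And>i. i < c \<Longrightarrow> P (G i)"
  shows "has_blocks P c X"
  unfolding has_blocks_def using assms by (intro exI[of _ G]) simp

lemma has_blocksE:
  assumes "has_blocks P c X"
  obtains G where "sorted_family (\<lless>) c G" "\<And>i. i < c \<Longrightarrow> G i \<subseteq> X" "\<And>i. i < c \<Longrightarrow> P (G i)"
proof -
  obtain G where "sorted_family (\<lless>) c G" "\<forall>i<c. G i \<subseteq> X \<and> P (G i)"
    using assms unfolding has_blocks_def by (elim exE conjE)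
  then show ?thesis by (intro that[of G]) simp_all
qed

lemma has_blocks_mono:
  assumes "has_blocks P c X" "X \<subseteq> Y" "d \<le> c"
  shows "has_blocks P d Y"
proof -
  obtain G where sorted: "sorted_family (\<lless>) c G"
    and sub: "\<And>i. i < c \<Longrightarrow> G i \<subseteq> X" and P_block: "\<And>i. i < c \<Longrightarrow> P (G i)"
    using has_blocksE[OF assms(1)] by metis
  show ?thesis
  proof (rule has_blocksI[of _ G])
    show "sorted_family (\<lless>) d G"
      using sorted_familyD[OF sorted] assms(3) by (intro sorted_familyI) simp
    show "G i \<subseteq> Y" "P (G i)" if "i < d" for i
      using sub[of i] P_block[of i] assms(2,3) that by (simp_all add: subset_trans)
  qed
qed

lemma has_blocks_0 [simp]: "has_blocks P 0 X"
  by (rule has_blocksI) (simp_all add: sorted_family_def)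

lemma has_blocks_1 [simp]: "has_blocks P (Suc 0) X \<longleftrightarrow> (\<exists>G\<subseteq>X. P G)"
  unfolding has_blocks_def sorted_family_def by auto

lemma has_blocks_imp_block:
  assumes "has_blocks P c X" "0 < c"
  obtains G where "G \<subseteq> X" "P G"
  using assms unfolding has_blocks_def by blast

lemma has_blocks_Un:
  assumes "has_blocks P c Y" "has_blocks P d Z" "Y \<lless> Z"
  shows "has_blocks P (c + d) (Y \<union> Z)"
proof -
  obtain G where sorted_G: "sorted_family (\<lless>) c G"
    and sub_G: "\<And>i. i < c \<Longrightarrow> G i \<subseteq> Y" and P_G: "\<And>i. i < c \<Longrightarrow> P (G i)"
    using has_blocksE[OF assms(1)] by metis
  obtain H where sorted_H: "sorted_family (\<lless>) d H"
    and sub_H: "\<And>i. i < d \<Longrightarrow> H i \<subseteq> Z" and P_H: "\<And>i. i < d \<Longrightarrow> P (H i)"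
    using has_blocksE[OF assms(2)] by metis
  define K where "K i = (if i < c then G i else H (i - c))" for i
  show ?thesis
  proof (rule has_blocksI[of _ K])
    show "sorted_family (\<lless>) (c + d) K"
    proof (rule sorted_familyI)
      fix i j assume ij: "i < j" "j < c + d"
      have "G i \<lless> H (j - c)" if "i < c" "c \<le> j"
        using less_sets_mono[OF assms(3) sub_G sub_H] ij that by simp
      with ij sorted_familyD[OF sorted_G, of i j] sorted_familyD[OF sorted_H, of "i - c" "j - c"]
      show "K i \<lless> K j" by (simp add: K_def)
    qed
    fix i assume "i < c + d"
    then have "i < c \<or> \<not> i < c \<and> i - c < d" by linarith
    then show "K i \<subseteq> Y \<union> Z" "P (K i)"
      using le_supI1[OF sub_G] le_supI2[OF sub_H] P_G P_H by (elim disjE; simp add: K_def)+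
  qed
qed

lemma has_blocks_add_iff:
  "has_blocks P (c + d) X \<longleftrightarrow>
     (\<exists>Y\<subseteq>X. \<exists>Z\<subseteq>X. Y \<lless> Z \<and> has_blocks P c Y \<and> has_blocks P d Z)"
proof
  assume "has_blocks P (c + d) X"
  then obtain G where sorted: "sorted_family (\<lless>) (c + d) G"
    and sub: "\<And>i. i < c + d \<Longrightarrow> G i \<subseteq> X" and P_block: "\<And>i. i < c + d \<Longrightarrow> P (G i)"
    by (rule has_blocksE) blast
  define Y Z where "Y = (\<Union>i<c. G i)" and "Z = (\<Union>i<d. G (c + i))"
  have "Y \<lless> Z"
    using less_setsD[OF sorted_familyD[OF sorted]] unfolding less_sets_def Y_def Z_def
    by (metis UN_E add_strict_left_mono lessThan_iff trans_less_add1)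
  moreover have "sorted_family (\<lless>) c G"
    using sorted_familyD[OF sorted] by (intro sorted_familyI) simp
  then have "has_blocks P c Y"
    by (rule has_blocksI) (use P_block in \<open>auto simp: Y_def\<close>)
  moreover have "sorted_family (\<lless>) d (\<lambda>i. G (c + i))"
    using sorted_familyD[OF sorted] by (intro sorted_familyI) simp
  then have "has_blocks P d Z"
    by (rule has_blocksI) (use P_block in \<open>auto simp: Z_def\<close>)
  moreover have "Y \<subseteq> X" "Z \<subseteq> X" unfolding Y_def Z_def by (intro UN_least sub; simp)+
  ultimately show "\<exists>Y\<subseteq>X. \<exists>Z\<subseteq>X. Y \<lless> Z \<and> has_blocks P c Y \<and> has_blocks P d Z"
    by blast
qed (meson Un_least has_blocks_Un has_blocks_mono order.refl)

lemma has_blocks_Suc_iff: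
  "has_blocks P (Suc c) X \<longleftrightarrow> (\<exists>Y\<subseteq>X. \<exists>Z\<subseteq>X. Y \<lless> Z \<and> P Y \<and> has_blocks P c Z)"
proof -
  have "(\<exists>Y\<subseteq>X. \<exists>Z\<subseteq>X. Y \<lless> Z \<and> (\<exists>G\<subseteq>Y. P G) \<and> has_blocks P c Z) \<longleftrightarrow>
      (\<exists>Y\<subseteq>X. \<exists>Z\<subseteq>X. Y \<lless> Z \<and> P Y \<and> has_blocks P c Z)"
    by (metis less_sets_mono subset_refl subset_trans)
  then show ?thesis using has_blocks_add_iff[of P "Suc 0" c X] by simp
qed

lemma has_blocks_snoc_iff:
  "has_blocks P (Suc c) X \<longleftrightarrow> (\<exists>Y\<subseteq>X. \<exists>Z\<subseteq>X. Y \<lless> Z \<and> has_blocks P c Y \<and> P Z)"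
proof -
  have "(\<exists>Y\<subseteq>X. \<exists>Z\<subseteq>X. Y \<lless> Z \<and> has_blocks P c Y \<and> (\<exists>G\<subseteq>Z. P G)) \<longleftrightarrow>
      (\<exists>Y\<subseteq>X. \<exists>Z\<subseteq>X. Y \<lless> Z \<and> has_blocks P c Y \<and> P Z)"
    by (metis less_sets_mono subset_refl subset_trans)
  then show ?thesis using has_blocks_add_iff[of P c "Suc 0" X] by simp
qed

lemma has_blocks_mult: "has_blocks P (c * d) X \<Longrightarrow> has_blocks (has_blocks P c) d X"
proof (induction d arbitrary: X)
  case (Suc d)
  then show ?case
    unfolding mult_Suc_right has_blocks_add_iff has_blocks_Suc_iff by blast
qed simp

lemma has_blocks_reindex:
  fixes I :: "nat set"
  assumes "finite I" "\<And>i. i \<in> I \<Longrightarrow> G i \<subseteq> X" "\<And>i. i \<in> I \<Longrightarrow> P (G i)"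
    and sorted: "\<And>i j. i \<in> I \<Longrightarrow> j \<in> I \<Longrightarrow> i < j \<Longrightarrow> G i \<lless> G j"
  shows "has_blocks P (card I) X"
proof -
  obtain l where bij: "bij_betw l {..<card I} I" and mono: "strict_mono_on {..<card I} l"
    using ex_bij_betw_strict_mono_card[OF assms(1)] .
  have l_in: "l i \<in> I" if "i < card I" for i using bij that by (auto dest: bij_betwE)
  show ?thesis
  proof (rule has_blocksI[of _ "G \<circ> l"])
    show "sorted_family (\<lless>) (card I) (G \<circ> l)"
      using sorted l_in strict_mono_onD[OF mono] by (intro sorted_familyI) simp
  qed (use assms(2,3) l_in in simp_all)
qed

text \<open>\<open>omega_large e X\<close> says that some subset of \<open>X\<close> is \<open>\<omega>\<^bsup>e\<^esup>\<close>-large, see \<open>omega_large_iff\<close>.\<close>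

primrec omega_large :: "nat \<Rightarrow> nat set \<Rightarrow> bool" where
  "omega_large 0 X \<longleftrightarrow> X \<noteq> {}"
| "omega_large (Suc e) X \<longleftrightarrow> (\<exists>x\<in>X. has_blocks (omega_large e) x (X \<inter> {x<..}))"

lemma omega_large_mono:
  assumes "omega_large e X" "X \<subseteq> Y"
  shows "omega_large e Y"
proof (cases e)
  case (Suc d)
  then obtain x where "x \<in> X" "has_blocks (omega_large d) x (X \<inter> {x<..})" using assms(1) by auto
  moreover from this have "has_blocks (omega_large d) x (Y \<inter> {x<..})"
    using assms(2) by (auto intro: has_blocks_mono)
  ultimately show ?thesis using assms(2) Suc by auto
qed (use assms in auto)

lemma omega_large_nonempty: "omega_large e X \<Longrightarrow> X \<noteq> {}"
  by (cases e) auto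

lemma has_blocks_omega_large_nonempty:
  assumes "has_blocks (omega_large e) c X" "0 < c"
  shows "X \<noteq> {}"
proof -
  obtain G where "G \<subseteq> X" "omega_large e G" using has_blocks_imp_block[OF assms] .
  then show ?thesis using omega_large_nonempty by blast
qed

subsection \<open>Largeness and fundamental sequences\<close>

abbreviation fundseq_list :: "ord_cnf \<Rightarrow> nat list \<Rightarrow> ord_cnf" where
  "fundseq_list \<alpha> xs \<equiv> fold (\<lambda>x \<beta>. fundseq \<beta> x) xs \<alpha>"

lemma fundseq_snoc_zero [simp]: "fundseq (CNF (as @ [ord_of_nat 0])) x = CNF as"
  by (simp add: fundseq.simps ord_of_nat_def)

lemma fundseq_snoc_Suc [simp]:
  "fundseq (CNF (as @ [ord_of_nat (Suc e)])) x = CNF (as @ replicate x (ord_of_nat e))"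
proof -
  have "exponents (ord_of_nat (Suc e)) = replicate e ord_zero @ [ord_zero]"
    by (simp add: ord_of_nat_def replicate_append_same)
  moreover have "ord_of_nat (Suc e) \<noteq> ord_zero" by (simp add: ord_of_nat_def)
  ultimately show ?thesis by (simp add: fundseq.simps) (simp add: ord_of_nat_def)
qed

lemma fundseq_list_replicate_eq_zeroD:
  assumes last_term: "\<And>as xs. fundseq_list (CNF (as @ [\<gamma>])) xs = ord_zero \<Longrightarrow> sorted_wrt (<) xs \<Longrightarrow>
      \<exists>ys zs. xs = ys @ zs \<and> P (set ys) \<and> fundseq_list (CNF as) zs = ord_zero"
    and "fundseq_list (CNF (as @ replicate c \<gamma>)) xs = ord_zero" "sorted_wrt (<) xs"
  shows "\<exists>ys zs. xs = ys @ zs \<and> has_blocks P c (set ys) \<and> fundseq_list (CNF as) zs = ord_zero"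
  using assms(2,3)
proof (induction c arbitrary: xs)
  case 0
  then show ?case by (intro exI[of _ "[]"] exI[of _ xs]) simp
next
  case (Suc c)
  have "fundseq_list (CNF ((as @ replicate c \<gamma>) @ [\<gamma>])) xs = ord_zero"
    using Suc.prems(1) by (simp add: replicate_append_same)
  from last_term[OF this Suc.prems(2)] obtain us vs where xs: "xs = us @ vs" and P_us: "P (set us)"
    and vanish: "fundseq_list (CNF (as @ replicate c \<gamma>)) vs = ord_zero"
    by blast
  have sorted: "sorted_wrt (<) vs" and less: "\<forall>u\<in>set us. \<forall>v\<in>set vs. u < v"
    using Suc.prems(2) xs by (simp_all add: sorted_wrt_append)
  obtain ys zs where vs: "vs = ys @ zs" and blocks: "has_blocks P c (set ys)"
    and rest: "fundseq_list (CNF as) zs = ord_zero"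
    using Suc.IH[OF vanish sorted] by blast
  have "set us \<lless> set ys" using less vs by (simp add: less_sets_def)
  then have "has_blocks P (Suc c) (set (us @ ys))"
    unfolding has_blocks_Suc_iff using P_us blocks by auto
  then show ?case using xs vs rest by (intro exI[of _ "us @ ys"] exI[of _ zs]) simp
qed

lemma fundseq_list_eq_zeroD:
  assumes "fundseq_list (CNF (as @ [ord_of_nat e])) xs = ord_zero" "sorted_wrt (<) xs"
  shows "\<exists>ys zs. xs = ys @ zs \<and> omega_large e (set ys) \<and> fundseq_list (CNF as) zs = ord_zero"
  using assms
proof (induction e arbitrary: as xs)
  case 0
  then obtain x zs where "xs = x # zs" by (cases xs) auto
  with 0 show ?case by (intro exI[of _ "[x]"] exI[of _ zs]) simp
next
  case (Suc e)
  then obtain x us where xs: "xs = x # us" by (cases xs) auto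
  then have "fundseq_list (CNF (as @ replicate x (ord_of_nat e))) us = ord_zero"
      "sorted_wrt (<) us"
    using Suc.prems by simp_all
  then obtain ys zs where us: "us = ys @ zs" and blocks: "has_blocks (omega_large e) x (set ys)"
    and rest: "fundseq_list (CNF as) zs = ord_zero"
    using fundseq_list_replicate_eq_zeroD[of "ord_of_nat e" "omega_large e"] Suc.IH by blast
  have "set ys \<subseteq> set (x # ys) \<inter> {x<..}" using Suc.prems(2) xs us by auto
  then have "omega_large (Suc e) (set (x # ys))"
    using has_blocks_mono[OF blocks] by fastforce
  with xs us rest show ?case by (intro exI[of _ "x # ys"] exI[of _ zs]) simp
qed

lemma has_blocks_fundseq_list:
  assumes last_term: "\<And>Y. P Y \<Longrightarrow> \<exists>xs. set xs \<subseteq> Y \<and> sorted_wrt (<) xs \<and>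
      (\<forall>as. fundseq_list (CNF (as @ [\<gamma>])) xs = CNF as)"
    and "has_blocks P c X"
  shows "\<exists>xs. set xs \<subseteq> X \<and> sorted_wrt (<) xs \<and>
    (\<forall>as. fundseq_list (CNF (as @ replicate c \<gamma>)) xs = CNF as)"
  using assms(2)
proof (induction c arbitrary: X)
  case 0
  then show ?case by (intro exI[of _ "[]"]) simp
next
  case (Suc c)
  obtain Y Z where YZ: "Y \<subseteq> X" "Z \<subseteq> X" "Y \<lless> Z" and "P Y" "has_blocks P c Z"
    using Suc.prems unfolding has_blocks_Suc_iff by blast
  obtain ys where ys: "set ys \<subseteq> Y" "sorted_wrt (<) ys"
    and strip_ys: "\<forall>as. fundseq_list (CNF (as @ [\<gamma>])) ys = CNF as"
    using last_term[OF \<open>P Y\<close>] by blast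
  obtain zs where zs: "set zs \<subseteq> Z" "sorted_wrt (<) zs"
    and strip_zs: "\<forall>as. fundseq_list (CNF (as @ replicate c \<gamma>)) zs = CNF as"
    using Suc.IH[OF \<open>has_blocks P c Z\<close>] by blast
  have "\<forall>y\<in>set ys. \<forall>z\<in>set zs. y < z"
    using less_sets_mono[OF YZ(3) ys(1) zs(1)] by (simp add: less_sets_def)
  moreover have "as @ replicate (Suc c) \<gamma> = (as @ replicate c \<gamma>) @ [\<gamma>]" for as
    by (simp add: replicate_append_same)
  then have "fundseq_list (CNF (as @ replicate (Suc c) \<gamma>)) (ys @ zs) = CNF as" for as
    using strip_ys strip_zs by (simp del: replicate_Suc append_assoc)
  ultimately show ?case
    using YZ(1,2) ys zs by (intro exI[of _ "ys @ zs"]) (auto simp: sorted_wrt_append)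
qed

lemma omega_large_fundseq_list:
  "omega_large e X \<Longrightarrow> \<exists>xs. set xs \<subseteq> X \<and> sorted_wrt (<) xs \<and>
     (\<forall>as. fundseq_list (CNF (as @ [ord_of_nat e])) xs = CNF as)"
proof (induction e arbitrary: X)
  case 0
  then obtain x where "x \<in> X" by auto
  then show ?case by (intro exI[of _ "[x]"]) simp
next
  case (Suc e)
  then obtain x where head: "x \<in> X" and blocks: "has_blocks (omega_large e) x (X \<inter> {x<..})"
    by auto
  obtain xs where "set xs \<subseteq> X \<inter> {x<..}" "sorted_wrt (<) xs"
      "\<forall>as. fundseq_list (CNF (as @ replicate x (ord_of_nat e))) xs = CNF as"
    using has_blocks_fundseq_list[OF Suc.IH blocks] by blast
  then show ?case using head by (intro exI[of _ "x # xs"]) auto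
qed

lemma omega_large_iff:
  "omega_large e X \<longleftrightarrow> (\<exists>H\<subseteq>X. large (omega_pow (ord_of_nat e)) H)"
proof
  assume "omega_large e X"
  then obtain xs where sub: "set xs \<subseteq> X" and sorted: "sorted_wrt (<) xs"
    and vanish: "fundseq_list (CNF ([] @ [ord_of_nat e])) xs = CNF []"
    using omega_large_fundseq_list by blast
  have "sorted_list_of_set (set xs) = xs"
    using sorted by (simp add: sorted_list_of_set.idem_if_sorted_distinct strict_sorted_iff)
  then have "large (omega_pow (ord_of_nat e)) (set xs)"
    using vanish by (simp add: large_def fundseq_set_def omega_pow_def)
  with sub show "\<exists>H\<subseteq>X. large (omega_pow (ord_of_nat e)) H" by blast
next
  assume "\<exists>H\<subseteq>X. large (omega_pow (ord_of_nat e)) H"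
  then obtain H where sub: "H \<subseteq> X" and fin: "finite H"
    and vanish: "fundseq_list (CNF ([] @ [ord_of_nat e])) (sorted_list_of_set H) = ord_zero"
    by (auto simp: large_def fundseq_set_def omega_pow_def)
  obtain ys zs where split: "sorted_list_of_set H = ys @ zs" and "omega_large e (set ys)"
    using fundseq_list_eq_zeroD[OF vanish] by (meson strict_sorted_list_of_set)
  moreover have "set ys \<subseteq> X"
    using sub fin split by (metis Un_upper1 set_append set_sorted_list_of_set subset_trans)
  ultimately show "omega_large e X" using omega_large_mono by blast
qed

subsection \<open>Growth and sparse subsets\<close>

lemma has_blocks_funpow_le:
  assumes "mono g" and step: "\<And>Y y. P Y \<Longrightarrow> {y} \<lless> Y \<Longrightarrow> \<exists>d\<in>Y. g y \<le> d"
    and "has_blocks P c X" "{y} \<lless> X"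
  shows "\<exists>d\<in>insert y X. (g ^^ c) y \<le> d"
  using assms(3,4)
proof (induction c arbitrary: X)
  case (Suc c)
  then obtain Y Z where sub: "Y \<subseteq> X" "Z \<subseteq> X" and "Y \<lless> Z" "has_blocks P c Y" "P Z"
    unfolding has_blocks_snoc_iff by blast
  have "{y} \<lless> Y" "{y} \<lless> Z" using Suc.prems(2) sub less_sets_mono by blast+
  then obtain d where grown: "d \<in> insert y Y" "(g ^^ c) y \<le> d"
    using Suc.IH[OF \<open>has_blocks P c Y\<close>] by blast
  have "{d} \<lless> Z" using grown(1) \<open>Y \<lless> Z\<close> \<open>{y} \<lless> Z\<close> by (auto simp: less_sets_def)
  then obtain z where "z \<in> Z" "g d \<le> z" using step[OF \<open>P Z\<close>] by blast
  moreover have "(g ^^ Suc c) y \<le> g d" using grown(2) monoD[OF \<open>mono g\<close>] by simp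
  ultimately show ?case using sub(2) by (intro bexI[of _ z]) auto
qed simp

lemma omega_large_exponent_less:
  "omega_large e X \<Longrightarrow> {y} \<lless> X \<Longrightarrow> \<exists>d\<in>X. y + e < d"
proof (induction e arbitrary: X y)
  case 0
  then show ?case by (auto simp: less_sets_def)
next
  case (Suc e)
  then obtain x where "x \<in> X" and blocks: "has_blocks (omega_large e) x (X \<inter> {x<..})" by auto
  then have "y < x" using Suc.prems(2) by (simp add: less_sets_def)
  then obtain G where block: "G \<subseteq> X \<inter> {x<..}" "omega_large e G"
    using has_blocks_imp_block[OF blocks] by auto
  then have "{x} \<lless> G" by (auto simp: less_sets_def)
  then obtain d where "d \<in> G" "x + e < d" using Suc.IH[OF block(2)] by blast
  then show ?case using \<open>y < x\<close> block(1) by (intro bexI[of _ d]) auto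
qed

lemma omega_large_double_le:
  assumes "omega_large (Suc e) X" "{y} \<lless> X"
  shows "\<exists>d\<in>X. 2 * y \<le> d"
proof -
  obtain x where "x \<in> X" and blocks: "has_blocks (omega_large e) x (X \<inter> {x<..})"
    using assms(1) by auto
  have "\<exists>d\<in>Z. Suc z \<le> d" if "omega_large e Z" "{z} \<lless> Z" for Z z
    using omega_large_nonempty[OF that(1)] that(2) by (auto simp: less_sets_def Suc_le_eq)
  then have "\<exists>d\<in>insert x (X \<inter> {x<..}). (Suc ^^ x) x \<le> d"
    using blocks by (intro has_blocks_funpow_le[of Suc "omega_large e"])
      (auto simp: mono_Suc less_sets_def)
  then obtain d where "d \<in> insert x (X \<inter> {x<..})" "(Suc ^^ x) x \<le> d" by blast
  moreover have "(Suc ^^ x) x = 2 * x" using Suc_funpow[of x] by (simp add: mult_2)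
  moreover have "y < x" using assms(2) \<open>x \<in> X\<close> by (simp add: less_sets_def)
  ultimately show ?thesis using \<open>x \<in> X\<close> by (intro bexI[of _ d]) auto
qed

lemma funpow_double: "((*) 2 ^^ n) x = 2 ^ n * (x :: nat)"
  by (induction n) simp_all

lemma omega_large_power_le:
  assumes "omega_large (Suc (Suc e)) X" "{y} \<lless> X"
  shows "\<exists>d\<in>X. 2 ^ y \<le> d"
proof -
  obtain x where "x \<in> X" and blocks: "has_blocks (omega_large (Suc e)) x (X \<inter> {x<..})"
    using assms(1) by auto
  have "\<exists>d\<in>insert x (X \<inter> {x<..}). ((*) 2 ^^ x) x \<le> d"
    using blocks omega_large_double_le
    by (intro has_blocks_funpow_le[of "(*) 2" "omega_large (Suc e)"])
      (auto intro: monoI simp: less_sets_def)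
  then obtain d where "d \<in> insert x (X \<inter> {x<..})" "2 ^ x * x \<le> d"
    unfolding funpow_double by blast
  moreover have "(2::nat) ^ y * 1 \<le> 2 ^ x * x"
    using assms(2) \<open>x \<in> X\<close> by (intro mult_le_mono power_increasing) (auto simp: less_sets_def)
  ultimately show ?thesis using \<open>x \<in> X\<close> by (intro bexI[of _ d]) auto
qed

definition double_exp :: "nat \<Rightarrow> nat" where
  "double_exp y = 2 ^ 2 ^ y"

lemma double_exp_gap:
  assumes blocks: "has_blocks (omega_large (Suc (Suc e))) 2 D"
    and "A \<lless> D" "D \<lless> B" "a \<in> A" "b \<in> B"
  shows "double_exp a \<le> b"
proof -
  have "{a} \<lless> D" using assms(2,4) by (auto simp: less_sets_def)
  then have "\<exists>d\<in>insert a D. ((^) 2 ^^ 2) a \<le> d"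
    using blocks omega_large_power_le
    by (intro has_blocks_funpow_le[of _ "omega_large (Suc (Suc e))"])
      (auto intro!: monoI power_increasing)
  then obtain d where "d \<in> insert a D" "double_exp a \<le> d"
    by (auto simp: double_exp_def numeral_2_eq_2)
  moreover have "d < b" if "d \<in> insert a D" for d
  proof -
    obtain g where "g \<in> D" using has_blocks_omega_large_nonempty[OF blocks] by auto
    with that assms show ?thesis by (fastforce simp: less_sets_def)
  qed
  ultimately show ?thesis by force
qed

definition sparse :: "(nat \<Rightarrow> nat) \<Rightarrow> nat set \<Rightarrow> bool" where
  "sparse h X \<longleftrightarrow> (\<forall>x\<in>X. \<forall>y\<in>X. x < y \<longrightarrow> h x \<le> y)"

lemma sparseD: "sparse h X \<Longrightarrow> x \<in> X \<Longrightarrow> y \<in> X \<Longrightarrow> x < y \<Longrightarrow> h x \<le> y"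
  by (simp add: sparse_def)

lemma sparse_subset: "sparse h X \<Longrightarrow> Y \<subseteq> X \<Longrightarrow> sparse h Y"
  unfolding sparse_def by blast

lemma sparse_Un:
  assumes "sparse h A" "sparse h B" "A \<lless> B" "\<And>a b. a \<in> A \<Longrightarrow> b \<in> B \<Longrightarrow> h a \<le> b"
  shows "sparse h (A \<union> B)"
  using assms unfolding sparse_def less_sets_def by (metis UnE less_asym)

text \<open>Of each four blocks, two are thinned out and the other two separate them from the past.\<close>

lemma sparse_blocks:
  fixes e
  defines "L \<equiv> omega_large (Suc (Suc e))"
  assumes thin: "\<And>Z. Z \<subseteq> X \<Longrightarrow> has_blocks L 2 Z \<Longrightarrow> \<exists>Y\<subseteq>Z. sparse double_exp Y \<and> P Y"
    and "has_blocks (has_blocks L 4) c X" "{v} \<lless> X"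
  shows "\<exists>Y\<subseteq>X. sparse double_exp (insert v Y) \<and> has_blocks P c Y"
  using assms(2-)
proof (induction c arbitrary: X)
  case 0
  then show ?case by (intro exI[of _ "{}"]) (simp add: sparse_def)
next
  case (Suc c)
  obtain A B where sub: "A \<subseteq> X" "B \<subseteq> X" and "A \<lless> B"
    and blocks_A: "has_blocks (has_blocks L 4) c A" and "has_blocks L (2 + 2) B"
    using Suc.prems(2) unfolding has_blocks_snoc_iff by auto
  then obtain D E where sub_B: "D \<subseteq> B" "E \<subseteq> B" and "D \<lless> E"
    and blocks_D: "has_blocks L 2 D" and blocks_E: "has_blocks L 2 E"
    unfolding has_blocks_add_iff by blast
  obtain Z where thinned_Z: "Z \<subseteq> E" "sparse double_exp Z" "P Z"
    using Suc.prems(1)[OF _ blocks_E] sub(2) sub_B(2) by blast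
  have "{v} \<lless> A" using Suc.prems(3) sub(1) less_sets_mono by blast
  then obtain Y where thinned_Y: "Y \<subseteq> A" "sparse double_exp (insert v Y)" "has_blocks P c Y"
    using Suc.IH[OF _ blocks_A] Suc.prems(1) sub(1) by (meson subset_trans)
  have "insert v Y \<lless> B"
    using less_sets_mono[OF \<open>A \<lless> B\<close> thinned_Y(1)] Suc.prems(3) sub(2) by (auto simp: less_sets_def)
  then have less: "insert v Y \<lless> D" "D \<lless> Z" "insert v Y \<lless> Z"
    using \<open>D \<lless> E\<close> sub_B thinned_Z(1) by (blast intro: less_sets_mono)+
  have "double_exp a \<le> b" if "a \<in> insert v Y" "b \<in> Z" for a b
    using double_exp_gap[OF blocks_D[unfolded L_def] less(1,2) that] .
  then have "sparse double_exp (insert v Y \<union> Z)"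
    by (rule sparse_Un[OF thinned_Y(2) thinned_Z(2) less(3)])
  moreover have "Y \<lless> Z" using less(3) less_sets_mono by blast
  then have "has_blocks P (Suc c) (Y \<union> Z)"
    unfolding has_blocks_snoc_iff using thinned_Y(3) thinned_Z(3) by blast
  ultimately show ?case
    using thinned_Y(1) thinned_Z(1) sub_B(2) sub by (intro exI[of _ "Y \<union> Z"]) auto
qed

lemma four_times_le_two_power: "4 \<le> v \<Longrightarrow> 4 * v \<le> (2::nat) ^ v"
  by (induction v rule: dec_induct) auto

lemma two_blocks_imp_multiple_blocks:
  fixes e
  defines "L \<equiv> omega_large (Suc (Suc e))"
  assumes "has_blocks (omega_large (Suc (Suc (Suc e)))) 2 X" "\<forall>x\<in>X. 4 \<le> x"
  shows "\<exists>v\<in>X. has_blocks L (4 * v) (X \<inter> {v<..})"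
proof -
  obtain A B where sub: "A \<subseteq> X" "B \<subseteq> X" and "A \<lless> B"
    and large: "omega_large (Suc (Suc (Suc e))) A" "omega_large (Suc (Suc (Suc e))) B"
    using assms(2) unfolding numeral_2_eq_2 has_blocks_snoc_iff[of _ "Suc 0"] has_blocks_1
    by (meson less_sets_mono order.refl omega_large_mono)
  obtain v where "v \<in> A" and blocks_A: "has_blocks L v (A \<inter> {v<..})"
    using large(1) by (auto simp: L_def)
  obtain w where "w \<in> B" and blocks_B: "has_blocks L w (B \<inter> {w<..})"
    using large(2) by (auto simp: L_def)
  have "4 \<le> v" using \<open>v \<in> A\<close> sub(1) assms(3) by blast
  then obtain G where block: "G \<subseteq> A \<inter> {v<..}" "L G" using has_blocks_imp_block[OF blocks_A] by auto
  then have "{v} \<lless> G" by (auto simp: less_sets_def)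
  then obtain d where "d \<in> G" "2 ^ v \<le> d"
    using omega_large_power_le[OF block(2)[unfolded L_def]] by blast
  moreover from this have "d < w" using block(1) \<open>w \<in> B\<close> less_setsD[OF \<open>A \<lless> B\<close>] by blast
  ultimately have "4 * v \<le> w" using four_times_le_two_power[OF \<open>4 \<le> v\<close>] by linarith
  moreover have "B \<inter> {w<..} \<subseteq> X \<inter> {v<..}"
    using sub(2) less_setsD[OF \<open>A \<lless> B\<close> \<open>v \<in> A\<close> \<open>w \<in> B\<close>] by auto
  ultimately have "has_blocks L (4 * v) (X \<inter> {v<..})" using has_blocks_mono[OF blocks_B] by blast
  then show ?thesis using \<open>v \<in> A\<close> sub(1) by blast
qed

lemma omega_large_sparse_subset:
  assumes "has_blocks (omega_large (Suc (Suc e))) 2 X" "\<forall>x\<in>X. 4 \<le> x"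
  shows "\<exists>Y\<subseteq>X. sparse double_exp Y \<and> omega_large e Y"
  using assms
proof (induction e arbitrary: X)
  case 0
  obtain x where "x \<in> X" using has_blocks_omega_large_nonempty[OF 0(1)] by auto
  then show ?case by (intro exI[of _ "{x}"]) (simp add: sparse_def)
next
  case (Suc e)
  obtain v where "v \<in> X" and blocks: "has_blocks (omega_large (Suc (Suc e))) (4 * v) (X \<inter> {v<..})"
    using two_blocks_imp_multiple_blocks[OF Suc.prems] by blast
  have "\<exists>Y\<subseteq>X \<inter> {v<..}. sparse double_exp (insert v Y) \<and> has_blocks (omega_large e) v Y"
  proof (rule sparse_blocks)
    show "\<exists>Y\<subseteq>Z. sparse double_exp Y \<and> omega_large e Y"
      if "Z \<subseteq> X \<inter> {v<..}" "has_blocks (omega_large (Suc (Suc e))) 2 Z" for Z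
      using Suc.IH[OF that(2)] that(1) Suc.prems(2) by blast
  qed (use has_blocks_mult[OF blocks] in \<open>auto simp: less_sets_def\<close>)
  then obtain Y where thinned: "Y \<subseteq> X \<inter> {v<..}" "sparse double_exp (insert v Y)"
      "has_blocks (omega_large e) v Y"
    by blast
  have "Y \<subseteq> insert v Y \<inter> {v<..}" using thinned(1) by blast
  then have "omega_large (Suc e) (insert v Y)" using has_blocks_mono[OF thinned(3)] by auto
  then show ?case using thinned(1,2) \<open>v \<in> X\<close> by (intro exI[of _ "insert v Y"]) auto
qed

definition admissible :: "nat \<Rightarrow> nat \<Rightarrow> nat set \<Rightarrow> bool" where
  "admissible k N X \<longleftrightarrow> finite X \<and> sparse double_exp X \<and> (\<forall>x\<in>X. 15 \<le> x \<and> k \<le> x \<and> N \<le> x)"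

lemma admissible_subset:
  assumes "admissible k N X" "Y \<subseteq> X" "\<And>q. q \<in> Y \<Longrightarrow> M \<le> q"
  shows "admissible k M Y"
  using assms(1,3) finite_subset[OF assms(2)] sparse_subset[OF _ assms(2)] subsetD[OF assms(2)]
  by (simp add: admissible_def)

lemma omega_large_imp_admissible_blocks:
  assumes "omega_large (e + 3) X" "finite X" "\<forall>x\<in>X. 15 \<le> x" "k \<le> e"
  obtains Y where "Y \<subseteq> X" "admissible k 2 Y" "has_blocks (omega_large e) 3 Y"
proof -
  let ?L = "omega_large (Suc (Suc e))"
  obtain x where "x \<in> X" and blocks: "has_blocks ?L x (X \<inter> {x<..})"
    using assms(1) by (auto simp: numeral_3_eq_3)
  have "has_blocks ?L (Suc (4 * 3)) X"
    by (rule has_blocks_mono[OF blocks]) (use assms(3) \<open>x \<in> X\<close> in auto)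
  then obtain A B where sub: "A \<subseteq> X" "B \<subseteq> X" and "A \<lless> B" "?L A"
    and blocks_B: "has_blocks ?L (4 * 3) B"
    unfolding has_blocks_Suc_iff by blast
  have "{0} \<lless> A" using sub(1) assms(3) by (force simp: less_sets_def)
  then obtain v where "v \<in> A" "k \<le> v"
    using omega_large_exponent_less[OF \<open>?L A\<close>] assms(4) by fastforce
  then have "{v} \<lless> B" using \<open>A \<lless> B\<close> by (simp add: less_sets_def)
  have "\<forall>x\<in>B. 4 \<le> x" using sub(2) assms(3) by force
  then have "\<exists>Y\<subseteq>Z. sparse double_exp Y \<and> omega_large e Y" if "Z \<subseteq> B" "has_blocks ?L 2 Z" for Z
    using omega_large_sparse_subset[OF that(2)] that(1) by blast
  then have "\<exists>Y\<subseteq>B. sparse double_exp (insert v Y) \<and> has_blocks (omega_large e) 3 Y"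
    by (rule sparse_blocks[OF _ has_blocks_mult[OF blocks_B] \<open>{v} \<lless> B\<close>])
  then obtain Y where thinned: "Y \<subseteq> B" "sparse double_exp (insert v Y)"
      "has_blocks (omega_large e) 3 Y"
    by blast
  have "Y \<subseteq> X" using thinned(1) sub(2) by blast
  have "15 \<le> y \<and> k \<le> y \<and> 2 \<le> y" if "y \<in> Y" for y
  proof -
    have "15 \<le> y" using assms(3) \<open>Y \<subseteq> X\<close> that by blast
    moreover have "v < y" using less_setsD[OF \<open>{v} \<lless> B\<close>] thinned(1) that by blast
    ultimately show ?thesis using \<open>k \<le> v\<close> by linarith
  qed
  moreover have "sparse double_exp Y" using thinned(2) by (rule sparse_subset) blast
  ultimately have "admissible k 2 Y"
    using finite_subset[OF \<open>Y \<subseteq> X\<close> assms(2)] by (simp add: admissible_def)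
  then show ?thesis using that[OF \<open>Y \<subseteq> X\<close>] thinned(3) by blast
qed

subsection \<open>Partitions of sparse sets\<close>

lemma pigeonhole_card_fibre:
  assumes "f \<in> A \<rightarrow> B" "finite A" "finite B" "B \<noteq> {}" "card B * n \<le> card A"
  shows "\<exists>y\<in>B. n \<le> card {x \<in> A. f x = y}"
proof -
  obtain y where "y \<in> B" and fibre: "card A \<le> card (f -` {y} \<inter> A) * card B"
    using pigeonhole_card[OF assms(1-4)] by blast
  have "f -` {y} \<inter> A = {x \<in> A. f x = y}" by blast
  then have "card B * n \<le> card B * card {x \<in> A. f x = y}"
    using fibre assms(5) by (simp only: mult.commute[of _ "card B"])
  moreover have "0 < card B" using assms(3,4) by (simp add: card_gt_0_iff)
  ultimately show ?thesis using \<open>y \<in> B\<close> by auto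
qed

lemma has_blocks_pigeonhole:
  assumes "finite T" "T \<noteq> {}" "card T \<le> D" "t ` X \<subseteq> T"
    and nonempty: "\<And>Y. P Y \<Longrightarrow> Y \<noteq> {}"
    and class_ex: "\<And>Y. Y \<subseteq> X \<Longrightarrow> Q Y \<Longrightarrow> \<exists>c. P {x \<in> Y. t x = c}"
    and "has_blocks Q (D * M) X"
  shows "\<exists>c\<in>T. has_blocks P M {x \<in> X. t x = c}"
proof -
  obtain G where sorted: "sorted_family (\<lless>) (D * M) G"
    and sub: "\<And>i. i < D * M \<Longrightarrow> G i \<subseteq> X" and Q_block: "\<And>i. i < D * M \<Longrightarrow> Q (G i)"
    using has_blocksE[OF assms(7)] by metis
  obtain col where P_class: "\<And>i. i < D * M \<Longrightarrow> P {x \<in> G i. t x = col i}"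
    using class_ex[OF sub Q_block] by metis
  have "col i \<in> T" if "i < D * M" for i
  proof -
    have "{x \<in> G i. t x = col i} \<noteq> {}" using P_class[OF that] by (rule nonempty)
    then obtain x where "x \<in> G i" "col i = t x" by auto
    then show ?thesis using subsetD[OF sub[OF that]] assms(4) by auto
  qed
  then have "col \<in> {..<D * M} \<rightarrow> T" by simp
  moreover have "card T * M \<le> card {..<D * M}" using assms(3) by simp
  ultimately obtain c where "c \<in> T" and fibre: "M \<le> card {i \<in> {..<D * M}. col i = c}"
    using pigeonhole_card_fibre[OF _ finite_lessThan assms(1,2)] by metis
  define I where "I = {i \<in> {..<D * M}. col i = c}"
  have "has_blocks P (card I) {x \<in> X. t x = c}"
  proof (rule has_blocks_reindex)
    show "{x \<in> G i. t x = c} \<subseteq> {x \<in> X. t x = c}" if "i \<in> I" for i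
      using sub[of i] that by (auto simp: I_def)
    show "P {x \<in> G i. t x = c}" if "i \<in> I" for i using P_class[of i] that by (auto simp: I_def)
    show "{x \<in> G i. t x = c} \<lless> {x \<in> G j. t x = c}" if "i \<in> I" "j \<in> I" "i < j" for i j
      by (rule less_sets_mono[OF sorted_familyD[OF sorted]]) (use that in \<open>auto simp: I_def\<close>)
  qed (simp add: I_def)
  then have "has_blocks P M {x \<in> X. t x = c}"
    by (rule has_blocks_mono) (use fibre in \<open>simp_all add: I_def\<close>)
  then show ?thesis using \<open>c \<in> T\<close> by blast
qed

text \<open>A class containing an early element \<open>y\<close> becomes \<open>\<omega>\<^bsup>e+1\<^esup>\<close>-large as soon as it contains \<open>y\<close> many
  later \<open>\<omega>\<^bsup>e\<^esup>\<close>-large blocks, and by sparseness the head of \<open>W\<close> is big enough to provide them.\<close>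

lemma omega_large_Suc_class_of_early_elements:
  assumes sparse: "sparse h X" and growth: "\<forall>x\<in>X. D\<^sup>2 * x \<le> h x"
    and sub: "Y \<subseteq> X" "W \<subseteq> X" and "Y \<lless> W" and early: "t ` W \<subseteq> t ` Y"
    and fin: "finite (t ` Y)" and card: "card (t ` Y) \<le> D"
    and large: "omega_large (Suc e) W"
    and class_ex: "\<And>Z. Z \<subseteq> X \<Longrightarrow> has_blocks (omega_large e) D Z \<Longrightarrow>
      \<exists>c. omega_large e {x \<in> Z. t x = c}"
  shows "\<exists>c. omega_large (Suc e) {x \<in> X. t x = c}"
proof -
  obtain w where "w \<in> W" and blocks_w: "has_blocks (omega_large e) w (W \<inter> {w<..})"
    using large by auto
  define V where "V = W \<inter> {w<..}"
  have "V \<subseteq> W" by (simp add: V_def)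
  define M where "M = w div D\<^sup>2"
  have "\<exists>c\<in>t ` Y. has_blocks (omega_large e) M {x \<in> V. t x = c}"
  proof (rule has_blocks_pigeonhole[OF fin _ card _ omega_large_nonempty])
    show "t ` Y \<noteq> {}" using \<open>w \<in> W\<close> early by blast
    show "t ` V \<subseteq> t ` Y" using early \<open>V \<subseteq> W\<close> by blast
    show "\<exists>c. omega_large e {x \<in> Z. t x = c}" if "Z \<subseteq> V" "has_blocks (omega_large e) D Z" for Z
      using class_ex[OF _ that(2)] that(1) \<open>V \<subseteq> W\<close> sub(2) by blast
    have "has_blocks (omega_large e) (D * (D * M)) V"
      unfolding V_def
      by (rule has_blocks_mono[OF blocks_w])
        (simp_all add: M_def power2_eq_square flip: mult.assoc)
    then show "has_blocks (has_blocks (omega_large e) D) (D * M) V" by (rule has_blocks_mult)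
  qed
  then obtain y where "y \<in> Y" and blocks_y: "has_blocks (omega_large e) M {x \<in> V. t x = t y}"
    by blast
  have "y < w" by (rule less_setsD[OF \<open>Y \<lless> W\<close> \<open>y \<in> Y\<close> \<open>w \<in> W\<close>])
  then have "D\<^sup>2 * y \<le> w"
    using sparseD[OF sparse] growth sub \<open>y \<in> Y\<close> \<open>w \<in> W\<close> by (meson order.trans subsetD)
  moreover have "0 < D"
    using fin card \<open>y \<in> Y\<close> by (metis card_gt_0_iff empty_iff imageI less_le_trans)
  ultimately have "y \<le> M" by (simp add: M_def less_eq_div_iff_mult_less_eq mult.commute)
  moreover have "{x \<in> V. t x = t y} \<subseteq> {x \<in> X. t x = t y} \<inter> {y<..}"
    using sub(2) \<open>y < w\<close> by (auto simp: V_def)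
  ultimately have "has_blocks (omega_large e) y ({x \<in> X. t x = t y} \<inter> {y<..})"
    using has_blocks_mono[OF blocks_y] by blast
  then show ?thesis using \<open>y \<in> Y\<close> sub(1) by auto
qed

lemma omega_large_Suc_class:
  assumes "sparse h X" "\<forall>x\<in>X. D\<^sup>2 * x \<le> h x"
    and "finite (t ` X)" "card (t ` X) \<le> d" "0 < d" "d \<le> D"
    and "has_blocks (omega_large (Suc e)) d X"
    and class_ex: "\<And>Z. Z \<subseteq> X \<Longrightarrow> has_blocks (omega_large e) D Z \<Longrightarrow>
      \<exists>c. omega_large e {x \<in> Z. t x = c}"
  shows "\<exists>c. omega_large (Suc e) {x \<in> X. t x = c}"
  using assms
proof (induction d arbitrary: X)
  case (Suc d)
  note prems = Suc.prems
  obtain Y W where sub: "Y \<subseteq> X" "W \<subseteq> X" and "Y \<lless> W"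
    and blocks_Y: "has_blocks (omega_large (Suc e)) d Y" and large_W: "omega_large (Suc e) W"
    using prems(7) unfolding has_blocks_snoc_iff by blast
  have "t ` Y \<subseteq> t ` X" using sub(1) by blast
  then have fin_Y: "finite (t ` Y)" and card_Y: "card (t ` Y) \<le> card (t ` X)"
    using prems(3) by (auto intro: finite_subset card_mono)
  consider (early) "t ` W \<subseteq> t ` Y" | (one_class) "d = 0"
    | (missing) w where "w \<in> W" "t w \<notin> t ` Y" "d \<noteq> 0" by blast
  then show ?case
  proof cases
    case early
    have "card (t ` Y) \<le> D" using card_Y prems(4,6) by linarith
    then show ?thesis
      using omega_large_Suc_class_of_early_elements
        [OF prems(1,2) sub \<open>Y \<lless> W\<close> early fin_Y _ large_W prems(8)] by blast
  next
    case one_class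
    obtain w where w_in: "w \<in> W" using omega_large_nonempty[OF large_W] by blast
    have "card (t ` X) \<le> Suc 0" using prems(4) one_class by simp
    then have "{x \<in> X. t x = t w} = X"
      using prems(3) w_in sub(2) card_le_Suc0_iff_eq by blast
    then show ?thesis using omega_large_mono[OF large_W sub(2)] by metis
  next
    case missing
    then have "t ` Y \<subset> t ` X" using sub by blast
    then have "card (t ` Y) < card (t ` X)" using prems(3) by (rule psubset_card_mono[rotated])
    then have card_le: "card (t ` Y) \<le> d" using prems(4) by linarith
    have "\<exists>c. omega_large (Suc e) {x \<in> Y. t x = c}"
      by (rule Suc.IH[OF _ _ fin_Y card_le _ _ blocks_Y])
        (use prems(1,2,6,8) sub(1) missing(3) in \<open>auto intro: sparse_subset\<close>)
    then obtain c where "omega_large (Suc e) {x \<in> Y. t x = c}" ..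
    then have "omega_large (Suc e) {x \<in> X. t x = c}"
      by (rule omega_large_mono) (use sub(1) in blast)
    then show ?thesis ..
  qed
qed simp

lemma omega_large_class:
  assumes "sparse h X" "\<forall>x\<in>X. D\<^sup>2 * x \<le> h x" "finite (t ` X)" "card (t ` X) \<le> D" "0 < D"
    and "has_blocks (omega_large e) D X"
  shows "\<exists>c. omega_large e {x \<in> X. t x = c}"
  using assms
proof (induction e arbitrary: X)
  case 0
  obtain x where "x \<in> X" using has_blocks_omega_large_nonempty[OF 0(6,5)] by blast
  then show ?case by auto
next
  case (Suc e)
  show ?case
  proof (rule omega_large_Suc_class[OF Suc.prems(1-5) order.refl Suc.prems(6)])
    fix Z assume "Z \<subseteq> X" and blocks: "has_blocks (omega_large e) D Z"
    then have "t ` Z \<subseteq> t ` X" by blast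
    then have "finite (t ` Z)" "card (t ` Z) \<le> D"
      using Suc.prems(3,4) by (auto intro: finite_subset order.trans[OF card_mono])
    then show "\<exists>c. omega_large e {x \<in> Z. t x = c}"
      using Suc.IH[OF sparse_subset[OF Suc.prems(1) \<open>Z \<subseteq> X\<close>] _ _ _ Suc.prems(5) blocks]
        Suc.prems(2) \<open>Z \<subseteq> X\<close> by blast
  qed
qed

lemma has_blocks_class:
  assumes "sparse h X" "\<forall>x\<in>X. D\<^sup>2 * x \<le> h x"
    and "finite T" "T \<noteq> {}" "card T \<le> D" "t ` X \<subseteq> T"
    and "has_blocks (omega_large e) (D\<^sup>2 * M) X"
  shows "\<exists>c\<in>T. has_blocks (omega_large e) M {x \<in> X. t x = c}"
proof (rule has_blocks_pigeonhole[OF assms(3-6) omega_large_nonempty])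
  fix Y assume "Y \<subseteq> X" and blocks: "has_blocks (omega_large e) D Y"
  have "0 < D" using assms(3-5) by (metis card_gt_0_iff less_le_trans)
  have "t ` Y \<subseteq> T" using \<open>Y \<subseteq> X\<close> assms(6) by blast
  then have "finite (t ` Y)" "card (t ` Y) \<le> D"
    using assms(3,5) by (auto intro: finite_subset order.trans[OF card_mono])
  then show "\<exists>c. omega_large e {x \<in> Y. t x = c}"
    using omega_large_class[OF sparse_subset[OF assms(1) \<open>Y \<subseteq> X\<close>] _ _ _ \<open>0 < D\<close> blocks]
      assms(2) \<open>Y \<subseteq> X\<close> by blast
next
  show "has_blocks (has_blocks (omega_large e) D) (D * M) X"
    using assms(7) by (intro has_blocks_mult) (simp add: power2_eq_square mult.assoc)
qed

lemma has_blocks_simultaneous_class: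
  fixes t :: "'s \<Rightarrow> nat \<Rightarrow> nat"
  assumes "sparse h X" "\<forall>x\<in>X. (k ^ r)\<^sup>2 * x \<le> h x" "0 < k" "finite S" "card S \<le> r"
    and "\<And>s x. s \<in> S \<Longrightarrow> x \<in> X \<Longrightarrow> t s x < k"
    and "has_blocks (omega_large e) ((k ^ r)\<^sup>2 * M) X"
  shows "\<exists>Y\<subseteq>X. has_blocks (omega_large e) M Y \<and> (\<forall>s\<in>S. \<forall>x\<in>Y. \<forall>y\<in>Y. t s x = t s y)"
proof -
  define u where "u x = restrict (\<lambda>s. t s x) S" for x
  have "u ` X \<subseteq> S \<rightarrow>\<^sub>E {..<k}" using assms(6) by (auto simp: u_def)
  moreover have "finite (S \<rightarrow>\<^sub>E {..<k})" using assms(4) by (intro finite_PiE) auto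
  moreover have "S \<rightarrow>\<^sub>E {..<k} \<noteq> {}"
    using assms(3) by (simp add: PiE_eq_empty_iff lessThan_empty_iff)
  moreover have "card (S \<rightarrow>\<^sub>E {..<k}) \<le> k ^ r"
    using assms(3-5) by (simp add: card_PiE power_increasing)
  ultimately obtain c where "has_blocks (omega_large e) M {x \<in> X. u x = c}"
    using has_blocks_class[OF assms(1,2) _ _ _ _ assms(7)] by blast
  moreover have "t s x = t s y" if "u x = u y" "s \<in> S" for s x y
    using fun_cong[OF that(1), of s] that(2) by (simp add: u_def)
  ultimately show ?thesis by (intro exI[of _ "{x \<in> X. u x = c}"]) auto
qed

subsection \<open>Finite Ramsey numbers\<close>

definition homogeneous :: "('a set \<Rightarrow> 'b) \<Rightarrow> 'b \<Rightarrow> 'a set \<Rightarrow> bool" where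
  "homogeneous f c H \<longleftrightarrow> f ` [H]\<^bsup>2\<^esup> \<subseteq> {c}"

lemma homogeneous_iff: "homogeneous f c H \<longleftrightarrow> (\<forall>x\<in>H. \<forall>y\<in>H. x \<noteq> y \<longrightarrow> f {x, y} = c)"
  by (auto simp: homogeneous_def nsets_2_eq image_UN)

lemma homogeneous_insert:
  assumes "homogeneous f c H" "\<And>w. w \<in> H \<Longrightarrow> f {v, w} = c"
  shows "homogeneous f c (insert v H)"
  using assms by (auto simp: homogeneous_iff insert_commute)

lemma colour_less:
  "f \<in> [X]\<^bsup>2\<^esup> \<rightarrow> {..<k} \<Longrightarrow> x \<in> X \<Longrightarrow> y \<in> X \<Longrightarrow> x \<noteq> y \<Longrightarrow> f {x, y} < (k::nat)"
  by (auto simp: Pi_iff)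

lemma ex_popular_colour:
  assumes "f \<in> [V]\<^bsup>2\<^esup> \<rightarrow> {..<k}" "finite V" "v \<in> V" "0 < k" "k * n < card V"
  shows "\<exists>c<k. n \<le> card {w \<in> V - {v}. f {v, w} = c}"
proof -
  have "(\<lambda>w. f {v, w}) \<in> V - {v} \<rightarrow> {..<k}" using colour_less[OF assms(1,3)] by auto
  moreover have "card {..<k} * n \<le> card (V - {v})" using assms(3,5) by simp
  ultimately show ?thesis
    using pigeonhole_card_fibre[of "\<lambda>w. f {v, w}" "V - {v}" "{..<k}"] assms(2,4) by auto
qed

lemma partn_lst_vertex_step:
  fixes q :: "nat list" and c :: nat
  defines "q' \<equiv> q[c := q ! c - 1]"
  assumes "f \<in> [V]\<^bsup>2\<^esup> \<rightarrow> {..<length q}" "v \<in> V" "c < length q" "0 < q ! c"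
    and "partn_lst {w \<in> V - {v}. f {v, w} = c} q' 2"
  shows "\<exists>i<length q. monochromatic V (q ! i) 2 f i"
proof -
  let ?U = "{w \<in> V - {v}. f {v, w} = c}"
  have len: "length q' = length q" by (simp add: q'_def)
  have "f \<in> [?U]\<^bsup>2\<^esup> \<rightarrow> {..<length q}" using assms(2) nsets_mono[of ?U V 2] by auto
  from assms(6) this len obtain i H where "i < length q'"
    and H_nset: "H \<in> [?U]\<^bsup>(q' ! i)\<^esup>" and hom: "homogeneous f i H"
    unfolding homogeneous_def by (rule partn_lstE)
  show ?thesis
  proof (cases "i = c")
    case True
    have "insert v H \<in> [V]\<^bsup>(q ! c)\<^esup>"
      using H_nset True assms(3-5) by (auto simp: nsets_def card_insert_if q'_def)
    moreover have "homogeneous f c (insert v H)"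
      using H_nset hom True by (intro homogeneous_insert) (auto simp: nsets_def)
    ultimately have "monochromatic V (q ! c) 2 f c"
      unfolding monochromatic_def homogeneous_def by (rule bexI[rotated])
    then show ?thesis using assms(4) by auto
  next
    case False
    then have "H \<in> [V]\<^bsup>(q ! i)\<^esup>" using H_nset by (auto simp: nsets_def q'_def)
    then have "monochromatic V (q ! i) 2 f i"
      using hom unfolding monochromatic_def homogeneous_def by (rule bexI[rotated])
    then show ?thesis using \<open>i < length q'\<close> len by auto
  qed
qed

lemma partn_lst_power:
  assumes "q \<noteq> []" "finite V" "(length q + 1) ^ sum_list q \<le> card V"
  shows "partn_lst V q 2"
  using assms
proof (induction "sum_list q" arbitrary: q V)
  case 0
  then show ?case by (cases q) (auto intro: partn_lst_0)
next
  case (Suc s)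
  define k where "k = length q"
  have "0 < k" using Suc.prems(1) by (simp add: k_def)
  have "k * (k + 1) ^ s < (k + 1) * (k + 1) ^ s" by simp
  also have "\<dots> \<le> card V"
    using Suc.prems(3) unfolding Suc.hyps(2)[symmetric] by (simp add: k_def)
  finally have card_V: "k * (k + 1) ^ s < card V" .
  then obtain v where "v \<in> V" by fastforce
  show ?case
    unfolding partn_lst_def
  proof
    fix f assume colouring: "f \<in> [V]\<^bsup>2\<^esup> \<rightarrow> {..<length q}"
    then obtain c where "c < k" and popular: "(k + 1) ^ s \<le> card {w \<in> V - {v}. f {v, w} = c}"
      using ex_popular_colour[OF _ Suc.prems(2) \<open>v \<in> V\<close> \<open>0 < k\<close> card_V] unfolding k_def by blast
    show "\<exists>i<length q. monochromatic V (q ! i) 2 f i"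
    proof (cases "q ! c = 0")
      case True
      then have "monochromatic V (q ! c) 2 f c" by (simp add: monochromatic_def nsets_empty_iff)
      then show ?thesis using \<open>c < k\<close> k_def by blast
    next
      case False
      let ?q = "q[c := q ! c - 1]" and ?U = "{w \<in> V - {v}. f {v, w} = c}"
      have "sum_list ?q = s"
        using Suc.hyps(2) False \<open>c < k\<close> elem_le_sum_list[of c q]
        by (simp add: sum_list_update k_def)
      then have "partn_lst ?U ?q 2"
        using Suc.hyps(1)[of ?q ?U] Suc.prems(1,2) popular by (simp add: k_def)
      then show ?thesis
        using partn_lst_vertex_step[OF colouring \<open>v \<in> V\<close>] \<open>c < k\<close> False by (simp add: k_def)
    qed
  qed
qed

lemma partn_power:
  assumes "0 < k"
  shows "partn {..<(k + 1) ^ (k * r)} r 2 {..<k}"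
  using partn_lst_power[of "replicate k r" "{..<(k + 1) ^ (k * r)}"] assms
  by (auto simp: partn_lst_def partn_def sum_list_replicate cong: conj_cong)

lemma partn_self: "partn {..<r} r r B"
  by (auto simp: partn_def monochromatic_def)

lemma partn_strict_monoE:
  assumes "partn {..<N} r 2 {..<k}" "f \<in> [{..<N::nat}]\<^bsup>2\<^esup> \<rightarrow> {..<k::nat}"
  obtains c l where "c < k" "l \<in> {..<r} \<rightarrow> {..<N}" "strict_mono_on {..<r} l"
    and "\<And>s t. s < t \<Longrightarrow> t < r \<Longrightarrow> f {l s, l t} = c"
proof -
  obtain c H where "c < k" and H_nset: "H \<in> [{..<N}]\<^bsup>r\<^esup>" and hom: "homogeneous f c H"
    using assms unfolding partn_def monochromatic_def homogeneous_def by blast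
  have "finite H" "card H = r" "H \<subseteq> {..<N}" using H_nset by (auto simp: nsets_def)
  then obtain l where bij: "bij_betw l {..<r} H" and mono: "strict_mono_on {..<r} l"
    using ex_bij_betw_strict_mono_card by metis
  have l_in: "l \<in> {..<r} \<rightarrow> H" using bij by (auto dest: bij_betwE)
  have "f {l s, l t} = c" if "s < t" "t < r" for s t
  proof -
    have "l s \<in> H" "l t \<in> H" using l_in that by auto
    moreover have "l s \<noteq> l t" using strict_mono_onD[OF mono, of s t] that by simp
    ultimately show ?thesis using hom by (simp add: homogeneous_iff)
  qed
  then show ?thesis using that[OF \<open>c < k\<close> _ mono] l_in \<open>H \<subseteq> {..<N}\<close> by blast
qed

subsection \<open>Blocks with constant cross colours\<close>

lemma choice_lessE:
  assumes "\<And>j. j < N \<Longrightarrow> \<exists>y. P j y"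
  obtains g where "\<forall>j<N. P j (g (j::nat))"
proof -
  have "\<forall>j\<in>{..<N}. \<exists>y. P j y" using assms by blast
  from bchoice[OF this] show ?thesis using that by blast
qed

definition constant_past_colours ::
    "(nat set \<Rightarrow> 'c) \<Rightarrow> nat \<Rightarrow> (nat \<Rightarrow> nat set) \<Rightarrow> (nat \<Rightarrow> nat set) \<Rightarrow> bool" where
  "constant_past_colours f N C B \<longleftrightarrow>
     (\<forall>j<N. \<forall>i<j. \<forall>p\<in>C i. \<forall>q\<in>B j. \<forall>q'\<in>B j. f {p, q} = f {p, q'})"

definition constant_future_colours ::
    "(nat set \<Rightarrow> 'c) \<Rightarrow> nat \<Rightarrow> (nat \<Rightarrow> nat set) \<Rightarrow> (nat \<Rightarrow> nat) \<Rightarrow> bool" where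
  "constant_future_colours f N A b \<longleftrightarrow>
     (\<forall>j<N. \<forall>i<j. \<forall>p\<in>A i. \<forall>p'\<in>A i. f {p, b j} = f {p', b j})"

definition cross_homogeneous :: "(nat set \<Rightarrow> 'c) \<Rightarrow> nat \<Rightarrow> (nat \<Rightarrow> nat set) \<Rightarrow> bool" where
  "cross_homogeneous f N A \<longleftrightarrow>
     (\<forall>j<N. \<forall>i<j. \<forall>p\<in>A i. \<forall>p'\<in>A i. \<forall>q\<in>A j. \<forall>q'\<in>A j. f {p, q} = f {p', q'})"

lemma cross_homogeneousD:
  "cross_homogeneous f N A \<Longrightarrow> i < j \<Longrightarrow> j < N \<Longrightarrow> p \<in> A i \<Longrightarrow> p' \<in> A i \<Longrightarrow> q \<in> A j \<Longrightarrow>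
     q' \<in> A j \<Longrightarrow> f {p, q} = f {p', q'}"
  unfolding cross_homogeneous_def by blast

lemma cross_homogeneous_of_constant_colours:
  assumes past: "constant_past_colours f N C B" and future: "constant_future_colours f N A b"
    and sub: "\<forall>j<N. A j \<subseteq> B j \<and> B j \<subseteq> C j \<and> b j \<in> B j"
  shows "cross_homogeneous f N A"
  unfolding cross_homogeneous_def
proof (intro allI impI ballI)
  fix j i p p' q q'
  assume "j < N" "i < j" and in_A: "p \<in> A i" "p' \<in> A i" "q \<in> A j" "q' \<in> A j"
  then have "i < N" by simp
  then have in_C: "p \<in> C i" "p' \<in> C i" and in_B: "q \<in> B j" "q' \<in> B j" "b j \<in> B j"
    using sub in_A \<open>j < N\<close> by blast+
  have "f {p, q} = f {p, b j}"
    using past in_C(1) in_B(1,3) \<open>i < j\<close> \<open>j < N\<close> unfolding constant_past_colours_def by blast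
  also have "\<dots> = f {p', b j}"
    using future in_A(1,2) \<open>i < j\<close> \<open>j < N\<close> unfolding constant_future_colours_def by blast
  also have "\<dots> = f {p', q'}"
    using past in_C(2) in_B(2,3) \<open>i < j\<close> \<open>j < N\<close> unfolding constant_past_colours_def by blast
  finally show "f {p, q} = f {p', q'}" .
qed

lemma ex_subblocks_constant_past_colours:
  fixes f :: "nat set \<Rightarrow> nat" and C :: "nat \<Rightarrow> nat set" and r L :: "nat \<Rightarrow> nat"
  assumes "f \<in> [X]\<^bsup>2\<^esup> \<rightarrow> {..<k}" "finite X" "sparse h X" "0 < k"
    and "sorted_family (\<lless>) N C" "\<forall>j<N. C j \<subseteq> X"
    and "\<forall>j<N. card (\<Union>i<j. C i) \<le> r j" "\<forall>j<N. \<forall>x\<in>C j. (k ^ r j)\<^sup>2 * x \<le> h x"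
    and "\<forall>j<N. has_blocks (omega_large e) ((k ^ r j)\<^sup>2 * L j) (C j)"
  shows "\<exists>B. constant_past_colours f N C B \<and>
    (\<forall>j<N. B j \<subseteq> C j \<and> has_blocks (omega_large e) (L j) (B j))"
proof -
  have "\<exists>B\<subseteq>C j. has_blocks (omega_large e) (L j) B \<and>
      (\<forall>p\<in>\<Union>i<j. C i. \<forall>q\<in>B. \<forall>q'\<in>B. f {p, q} = f {p, q'})" if "j < N" for j
  proof (rule has_blocks_simultaneous_class[where r = "r j", OF _ _ assms(4)])
    have C_sub: "C i \<subseteq> X" if "i \<le> j" for i using assms(6) \<open>j < N\<close> that by simp
    show "sparse h (C j)" using sparse_subset[OF assms(3) C_sub] by simp
    show "finite (\<Union>i<j. C i)" using finite_subset[OF C_sub assms(2)] by simp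
    fix p q assume "p \<in> (\<Union>i<j. C i)" "q \<in> C j"
    then obtain i where "i < j" "p \<in> C i" by blast
    show "f {p, q} < k"
    proof (rule colour_less[OF assms(1)])
      show "p \<in> X" "q \<in> X" using C_sub[of i] C_sub[of j] \<open>i < j\<close> \<open>p \<in> C i\<close> \<open>q \<in> C j\<close> by auto
      show "p \<noteq> q"
        using less_setsD[OF sorted_familyD[OF assms(5) \<open>i < j\<close> \<open>j < N\<close>] \<open>p \<in> C i\<close> \<open>q \<in> C j\<close>]
        by simp
    qed
  qed (use assms(7-9) that in blast)+
  then obtain B where subblocks: "\<forall>j<N. B j \<subseteq> C j \<and> has_blocks (omega_large e) (L j) (B j) \<and>
      (\<forall>p\<in>\<Union>i<j. C i. \<forall>q\<in>B j. \<forall>q'\<in>B j. f {p, q} = f {p, q'})"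
    by (rule choice_lessE) blast
  then have "constant_past_colours f N C B" unfolding constant_past_colours_def by blast
  with subblocks show ?thesis by blast
qed

lemma ex_subblocks_constant_future_colours:
  fixes f :: "nat set \<Rightarrow> nat" and C :: "nat \<Rightarrow> nat set" and r L :: "nat \<Rightarrow> nat"
  assumes "f \<in> [X]\<^bsup>2\<^esup> \<rightarrow> {..<k}" "sparse h X" "0 < k"
    and "sorted_family (\<lless>) N C" "\<forall>j<N. C j \<subseteq> X" "\<forall>j<N. b j \<in> C j"
    and "\<forall>j<N. N \<le> r j" "\<forall>j<N. \<forall>x\<in>C j. (k ^ r j)\<^sup>2 * x \<le> h x"
    and "\<forall>j<N. has_blocks (omega_large e) ((k ^ r j)\<^sup>2 * L j) (C j)"
  shows "\<exists>A. constant_future_colours f N A b \<and>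
    (\<forall>i<N. A i \<subseteq> C i \<and> has_blocks (omega_large e) (L i) (A i))"
proof -
  have "\<exists>A\<subseteq>C i. has_blocks (omega_large e) (L i) A \<and>
      (\<forall>j\<in>{i<..<N}. \<forall>p\<in>A. \<forall>p'\<in>A. f {p, b j} = f {p', b j})" if "i < N" for i
  proof (rule has_blocks_simultaneous_class[where r = "r i", OF _ _ assms(3)])
    show "sparse h (C i)" using sparse_subset[OF assms(2)] assms(5) \<open>i < N\<close> by blast
    fix j p assume "j \<in> {i<..<N}" "p \<in> C i"
    then have "i < j" "j < N" "b j \<in> C j" using assms(6) by auto
    show "f {p, b j} < k"
    proof (rule colour_less[OF assms(1)])
      show "p \<in> X" "b j \<in> X" using assms(5) \<open>p \<in> C i\<close> \<open>b j \<in> C j\<close> \<open>i < N\<close> \<open>j < N\<close> by auto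
      show "p \<noteq> b j"
        using less_setsD[OF sorted_familyD[OF assms(4) \<open>i < j\<close> \<open>j < N\<close>] \<open>p \<in> C i\<close> \<open>b j \<in> C j\<close>]
        by simp
    qed
  next
    have "card {i<..<N} \<le> N" by simp
    also have "N \<le> r i" using assms(7) \<open>i < N\<close> by blast
    finally show "card {i<..<N} \<le> r i" .
  qed (use assms(8,9) that finite_greaterThanLessThan in blast)+
  then obtain A where subblocks: "\<forall>i<N. A i \<subseteq> C i \<and> has_blocks (omega_large e) (L i) (A i) \<and>
      (\<forall>j\<in>{i<..<N}. \<forall>p\<in>A i. \<forall>p'\<in>A i. f {p, b j} = f {p', b j})"
    by (rule choice_lessE) blast
  then have "constant_future_colours f N A b"
    unfolding constant_future_colours_def by (meson greaterThanLessThan_iff order.strict_trans)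
  with subblocks show ?thesis by blast
qed

text \<open>Each block is thinned twice: first according to the colours its points receive from all points
  of the earlier blocks, then according to the colours its points give to the already thinned later
  blocks, each of which is represented by a single point.\<close>

lemma ex_cross_homogeneous_subblocks:
  fixes f :: "nat set \<Rightarrow> nat" and C :: "nat \<Rightarrow> nat set" and r L :: "nat \<Rightarrow> nat"
  assumes "f \<in> [X]\<^bsup>2\<^esup> \<rightarrow> {..<k}" "finite X" "sparse h X" "0 < k"
    and sorted: "sorted_family (\<lless>) N C" and sub_X: "\<forall>j<N. C j \<subseteq> X"
    and card_le: "\<forall>j<N. card (\<Union>i<j. C i) \<le> r j" and "\<forall>j<N. N \<le> r j"
    and growth: "\<forall>j<N. \<forall>x\<in>C j. (k ^ r j)\<^sup>2 * x \<le> h x" and "\<forall>j<N. 0 < L j"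
    and blocks: "\<forall>j<N. has_blocks (omega_large e) ((k ^ r j)\<^sup>2 * ((k ^ r j)\<^sup>2 * L j)) (C j)"
  shows "\<exists>A. cross_homogeneous f N A \<and>
    (\<forall>j<N. A j \<subseteq> C j \<and> has_blocks (omega_large e) (L j) (A j))"
proof -
  obtain B where past: "constant_past_colours f N C B"
    and B_blocks: "\<forall>j<N. B j \<subseteq> C j \<and> has_blocks (omega_large e) ((k ^ r j)\<^sup>2 * L j) (B j)"
    using ex_subblocks_constant_past_colours[OF assms(1-4) sorted sub_X card_le growth blocks]
    by (elim exE conjE)
  have "B j \<noteq> {}" if "j < N" for j
  proof (rule has_blocks_omega_large_nonempty)
    show "has_blocks (omega_large e) ((k ^ r j)\<^sup>2 * L j) (B j)" using B_blocks that by blast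
    show "0 < (k ^ r j)\<^sup>2 * L j" using assms(4,10) that by simp
  qed
  moreover define b where "b j = (SOME q. q \<in> B j)" for j
  ultimately have b_in: "\<forall>j<N. b j \<in> B j" by (simp add: some_in_eq)
  have "\<exists>A. constant_future_colours f N A b \<and>
      (\<forall>i<N. A i \<subseteq> B i \<and> has_blocks (omega_large e) (L i) (A i))"
  proof (rule ex_subblocks_constant_future_colours[OF assms(1,3,4) _ _ b_in assms(8)])
    show "sorted_family (\<lless>) N B"
      using B_blocks sorted less_sets_mono unfolding sorted_family_def by (meson order.strict_trans)
  qed (use B_blocks sub_X growth in blast)+
  then obtain A where "constant_future_colours f N A b"
    and A_blocks: "\<forall>i<N. A i \<subseteq> B i \<and> has_blocks (omega_large e) (L i) (A i)"
    by (elim exE conjE)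
  then have "cross_homogeneous f N A"
    using B_blocks b_in by (intro cross_homogeneous_of_constant_colours[OF past]) auto
  with A_blocks B_blocks show ?thesis by blast
qed

lemma six_cubes_le_two_power: "15 \<le> y \<Longrightarrow> 6 * y ^ 3 \<le> (2::nat) ^ y"
proof (induction y rule: dec_induct)
  case (step y)
  have "(y + 1) ^ 3 = y ^ 3 + (3 * y\<^sup>2 + 3 * y + 1)"
    by (simp add: power3_eq_cube power2_eq_square algebra_simps)
  also have "3 * y\<^sup>2 + 3 * y + 1 \<le> 15 * y\<^sup>2"
  proof -
    have "y \<le> y\<^sup>2" "1 \<le> y\<^sup>2" using step by (auto simp: power2_eq_square)
    then show ?thesis by linarith
  qed
  also have "\<dots> \<le> y ^ 3" using step by (simp add: power3_eq_cube power2_eq_square)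
  finally show ?case using step by simp
qed simp

lemma Suc_power_le_two_power: "(k + 1) ^ a \<le> (2::nat) ^ (k * a)"
proof -
  have "k + 1 \<le> (2::nat) ^ k" using less_exp[of k] by (metis Suc_eq_plus1 Suc_leI)
  then have "(k + 1) ^ a \<le> (2 ^ k) ^ a" by (rule power_mono) simp
  then show ?thesis by (simp add: power_mult)
qed

lemma power_le_double_exp:
  assumes "k \<le> y" "15 \<le> y"
  shows "(k + 1) ^ (k * (2 * y) + 5 * y) \<le> double_exp y"
proof -
  have "k * (k * (2 * y) + 5 * y) \<le> y * (y * (2 * y) + 5 * y)"
    using assms by (intro mult_le_mono add_mono) auto
  also have "\<dots> = 2 * y ^ 3 + 5 * y\<^sup>2" by (simp add: power3_eq_cube power2_eq_square algebra_simps)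
  also have "5 * y\<^sup>2 \<le> 4 * y ^ 3" using assms by (simp add: power3_eq_cube power2_eq_square)
  also have "2 * y ^ 3 + 4 * y ^ 3 \<le> 2 ^ y" using six_cubes_le_two_power[OF assms(2)] by simp
  finally have "(2::nat) ^ (k * (k * (2 * y) + 5 * y)) \<le> double_exp y"
    unfolding double_exp_def by (intro power_increasing) auto
  then show ?thesis using Suc_power_le_two_power order.trans by blast
qed

definition ramsey_bound :: "nat \<Rightarrow> nat \<Rightarrow> nat" where
  "ramsey_bound k y = (k + 1) ^ (k * (2 * y))"

lemma ramsey_bound_le_double_exp:
  assumes "k \<le> y" "15 \<le> y"
  shows "ramsey_bound k y \<le> double_exp y"
proof -
  have "ramsey_bound k y \<le> (k + 1) ^ (k * (2 * y) + 5 * y)"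
    unfolding ramsey_bound_def by (intro power_increasing) auto
  then show ?thesis using power_le_double_exp[OF assms] by linarith
qed

lemma classes_times_ramsey_bound_le_double_exp:
  assumes "0 < k" "k \<le> y" "15 \<le> y"
  shows "(k ^ y)\<^sup>2 * ((k ^ y)\<^sup>2 * Suc (ramsey_bound k y)) \<le> double_exp y"
proof -
  have classes_le: "(k ^ y)\<^sup>2 \<le> (k + 1) ^ (2 * y)"
    unfolding power_even_eq by (intro power_mono) auto
  have "Suc (ramsey_bound k y) \<le> 2 * ramsey_bound k y" by (simp add: ramsey_bound_def Suc_le_eq)
  also have "\<dots> \<le> (k + 1) ^ y * ramsey_bound k y"
    using assms power_increasing[of 1 y "k + 1"] by (intro mult_le_mono1) auto
  finally have "(k ^ y)\<^sup>2 * ((k ^ y)\<^sup>2 * Suc (ramsey_bound k y)) \<le>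
      (k + 1) ^ (2 * y) * ((k + 1) ^ (2 * y) * ((k + 1) ^ y * ramsey_bound k y))"
    using classes_le by (intro mult_le_mono)
  also have "\<dots> = (k + 1) ^ (k * (2 * y) + 5 * y)"
    by (simp add: ramsey_bound_def add.commute flip: power_add)
  finally show ?thesis using power_le_double_exp[OF assms(2,3)] by linarith
qed

lemma classes_times_le_double_exp:
  assumes "0 < k" "k \<le> x" "15 \<le> x" "y \<le> x"
  shows "(k ^ y)\<^sup>2 * x \<le> double_exp x"
proof -
  have "(k ^ y)\<^sup>2 = k ^ (2 * y)" by (rule power_even_eq[symmetric])
  also have "\<dots> \<le> k ^ (2 * x)" using assms by (intro power_increasing) auto
  also have "\<dots> \<le> (k + 1) ^ (2 * x)" by (intro power_mono) auto
  finally have "(k ^ y)\<^sup>2 \<le> (k + 1) ^ (2 * x)" .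
  moreover have "x \<le> (k + 1) ^ x"
    using less_exp[of x] power_mono[of 2 "k + 1" x] assms(1) by linarith
  ultimately have "(k ^ y)\<^sup>2 * x \<le> (k + 1) ^ (2 * x) * (k + 1) ^ x" by (rule mult_le_mono)
  also have "\<dots> = (k + 1) ^ (3 * x)" by (simp flip: power_add)
  also have "\<dots> \<le> (k + 1) ^ (k * (2 * x) + 5 * x)" by (intro power_increasing) auto
  finally show ?thesis using power_le_double_exp[OF assms(2,3)] by linarith
qed

text \<open>Because \<open>0\<close> is excluded, \<open>y j\<close> bounds not only the earlier elements but also their number.\<close>

definition separates :: "nat \<Rightarrow> (nat \<Rightarrow> nat) \<Rightarrow> (nat \<Rightarrow> nat set) \<Rightarrow> bool" where
  "separates N y C \<longleftrightarrow> (\<forall>j<N. (\<Union>i<j. C i) \<subseteq> {0<..y j} \<and> {y j} \<lless> C j)"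

lemma separates_past: "separates N y C \<Longrightarrow> j < N \<Longrightarrow> (\<Union>i<j. C i) \<subseteq> {0<..y j}"
  by (simp add: separates_def)

lemma separates_less: "separates N y C \<Longrightarrow> j < N \<Longrightarrow> {y j} \<lless> C j"
  by (simp add: separates_def)

lemma separates_imp_sorted_family:
  assumes "separates N y C"
  shows "sorted_family (\<lless>) N C"
proof (rule sorted_familyI, rule less_setsI)
  fix i j p q assume "i < j" "j < N" "p \<in> C i" "q \<in> C j"
  then have "p \<le> y j" "y j < q"
    using separates_past[OF assms \<open>j < N\<close>] less_setsD[OF separates_less[OF assms \<open>j < N\<close>]] by auto
  then show "p < q" by simp
qed

lemma separates_subset:
  assumes "separates N y C" "\<forall>j<N. A j \<subseteq> C j"
  shows "separates N y A"
  unfolding separates_def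
proof (intro allI impI conjI)
  fix j assume "j < N"
  then have "(\<Union>i<j. A i) \<subseteq> (\<Union>i<j. C i)" using assms(2) by (intro UN_mono) auto
  then show "(\<Union>i<j. A i) \<subseteq> {0<..y j}"
    using separates_past[OF assms(1) \<open>j < N\<close>] by (rule subset_trans)
  show "{y j} \<lless> A j"
    using less_sets_mono[OF separates_less[OF assms(1) \<open>j < N\<close>]] assms(2) \<open>j < N\<close> by blast
qed

lemma separates_Max:
  assumes sorted: "sorted_family (\<lless>) N C" and fin: "\<forall>j<N. finite (C j)" and less: "\<forall>j<N. {x} \<lless> C j"
  shows "separates N (\<lambda>j. Max (insert x (\<Union>i<j. C i))) C"
  unfolding separates_def
proof (intro allI impI conjI)
  fix j assume "j < N"
  let ?P = "insert x (\<Union>i<j. C i)"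
  have "finite ?P" using fin \<open>j < N\<close> by auto
  show "(\<Union>i<j. C i) \<subseteq> {0<..Max ?P}"
  proof
    fix q assume q_past: "q \<in> (\<Union>i<j. C i)"
    then obtain i where "i < N" "q \<in> C i"
      using \<open>j < N\<close> by (meson UN_E lessThan_iff order.strict_trans)
    then have "x < q" using less by (simp add: less_sets_def)
    moreover have "q \<le> Max ?P" using Max_ge[OF \<open>finite ?P\<close>] q_past by blast
    ultimately show "q \<in> {0<..Max ?P}" by simp
  qed
  have "?P \<lless> C j"
    using less \<open>j < N\<close> sorted_familyD[OF sorted _ \<open>j < N\<close>] by (auto simp: less_sets_def)
  moreover have "Max ?P \<in> ?P" using Max_in[OF \<open>finite ?P\<close>] by blast
  ultimately show "{Max ?P} \<lless> C j" by (auto intro: less_setsI dest: less_setsD)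
qed

lemma has_blocks_imp_separated_family:
  assumes "finite X" "has_blocks P (Suc N) X" "\<And>Y. P Y \<Longrightarrow> Y \<noteq> {}"
  shows "\<exists>y G. separates N y G \<and> (\<forall>j<N. y j \<in> X \<and> G j \<subseteq> X \<and> P (G j))"
proof -
  obtain Y Z where sub: "Y \<subseteq> X" "Z \<subseteq> X" and "Y \<lless> Z" "P Y" and blocks: "has_blocks P N Z"
    using assms(2) unfolding has_blocks_Suc_iff by blast
  obtain x where "x \<in> Y" using assms(3)[OF \<open>P Y\<close>] by blast
  obtain G where sorted: "sorted_family (\<lless>) N G" and sub_Z: "\<And>j. j < N \<Longrightarrow> G j \<subseteq> Z"
    and P_block: "\<And>j. j < N \<Longrightarrow> P (G j)"
    using has_blocksE[OF blocks] by metis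
  have sub_X: "G j \<subseteq> X" if "j < N" for j using subset_trans[OF sub_Z[OF that] sub(2)] .
  have fin: "finite (G j)" if "j < N" for j using finite_subset[OF sub_X[OF that] assms(1)] .
  define y where "y j = Max (insert x (\<Union>i<j. G i))" for j
  have "separates N y G"
    unfolding y_def
  proof (rule separates_Max[OF sorted]; intro allI impI)
    fix j assume "j < N"
    then show "finite (G j)" by (rule fin)
    show "{x} \<lless> G j"
      by (rule less_sets_mono[OF \<open>Y \<lless> Z\<close> _ sub_Z]) (simp_all add: \<open>x \<in> Y\<close> \<open>j < N\<close>)
  qed
  moreover have "y j \<in> X" if "j < N" for j
  proof -
    have "y j \<in> insert x (\<Union>i<j. G i)" unfolding y_def using fin that by (intro Max_in) simp_all
    then have "y j = x \<or> (\<exists>i<j. y j \<in> G i)" by blast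
    then show ?thesis
      using subsetD[OF sub_X] \<open>x \<in> Y\<close> sub(1) that by (meson order.strict_trans subsetD)
  qed
  ultimately show ?thesis using sub_X P_block by blast
qed

lemma ex_separated_multiple_blocks:
  assumes "finite X" "sparse h X" "has_blocks (omega_large (Suc e)) (Suc N) X"
  shows "\<exists>y C. separates N y C \<and>
    (\<forall>j<N. y j \<in> X \<and> C j \<subseteq> X \<and> has_blocks (omega_large e) (h (y j)) (C j))"
proof -
  have "\<exists>y G. separates N y G \<and> (\<forall>j<N. y j \<in> X \<and> G j \<subseteq> X \<and> omega_large (Suc e) (G j))"
    by (rule has_blocks_imp_separated_family[OF assms(1,3)]) (rule omega_large_nonempty)
  then obtain y G where sep: "separates N y G"
    and large: "\<forall>j<N. y j \<in> X \<and> G j \<subseteq> X \<and> omega_large (Suc e) (G j)"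
    by (elim exE conjE)
  have "\<exists>C\<subseteq>G j. has_blocks (omega_large e) (h (y j)) C" if "j < N" for j
  proof -
    have "y j \<in> X" "G j \<subseteq> X" "omega_large (Suc e) (G j)" using large that by blast+
    then obtain z where "z \<in> G j" and blocks_z: "has_blocks (omega_large e) z (G j \<inter> {z<..})"
      by auto
    then have "y j < z" "z \<in> X"
      using less_setsD[OF separates_less[OF sep that]] \<open>G j \<subseteq> X\<close> by auto
    then have "h (y j) \<le> z" using sparseD[OF assms(2) \<open>y j \<in> X\<close>] by blast
    then have "has_blocks (omega_large e) (h (y j)) (G j \<inter> {z<..})"
      by (rule has_blocks_mono[OF blocks_z order.refl])
    then show ?thesis by blast
  qed
  then obtain C where blocks: "\<forall>j<N. C j \<subseteq> G j \<and> has_blocks (omega_large e) (h (y j)) (C j)"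
    by (rule choice_lessE) blast
  then have "separates N y C" using separates_subset[OF sep] by blast
  moreover have "\<forall>j<N. C j \<subseteq> X" using blocks large by (meson subset_trans)
  ultimately show ?thesis using blocks large by blast
qed

lemma ex_cross_homogeneous_separated_subblocks:
  fixes f :: "nat set \<Rightarrow> nat"
  assumes "0 < k" "f \<in> [X]\<^bsup>2\<^esup> \<rightarrow> {..<k}" "admissible k N X" and sep: "separates N y C"
    and blocks: "\<forall>j<N. y j \<in> X \<and> C j \<subseteq> X \<and> has_blocks (omega_large e) (double_exp (y j)) (C j)"
  shows "\<exists>A. cross_homogeneous f N A \<and>
    (\<forall>j<N. A j \<subseteq> C j \<and> has_blocks (omega_large e) (Suc (ramsey_bound k (y j))) (A j))"
proof (rule ex_cross_homogeneous_subblocks[where r = y, OF assms(2) _ _ assms(1)];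
    (intro allI impI)?)
  show "finite X" "sparse double_exp X" using assms(3) by (simp_all add: admissible_def)
  show "sorted_family (\<lless>) N C" by (rule separates_imp_sorted_family[OF sep])
  fix j assume "j < N"
  then have low: "15 \<le> y j" "k \<le> y j" "N \<le> y j"
    using assms(3) blocks by (auto simp: admissible_def)
  show "N \<le> y j" by (rule low(3))
  show "C j \<subseteq> X" using blocks \<open>j < N\<close> by blast
  show "card (\<Union>i<j. C i) \<le> y j" using card_mono[OF _ separates_past[OF sep \<open>j < N\<close>]] by simp
  show "\<forall>q\<in>C j. (k ^ y j)\<^sup>2 * q \<le> double_exp q"
  proof (rule ballI, rule classes_times_le_double_exp[OF assms(1)])
    fix q assume "q \<in> C j"
    then have "y j < q" using separates_less[OF sep \<open>j < N\<close>] by (simp add: less_sets_def)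
    then show "k \<le> q" "15 \<le> q" "y j \<le> q" using low by linarith+
  qed
  show "has_blocks (omega_large e) ((k ^ y j)\<^sup>2 * ((k ^ y j)\<^sup>2 * Suc (ramsey_bound k (y j)))) (C j)"
  proof (rule has_blocks_mono[OF _ order.refl])
    show "has_blocks (omega_large e) (double_exp (y j)) (C j)" using blocks \<open>j < N\<close> by blast
  qed (rule classes_times_ramsey_bound_le_double_exp[OF assms(1) low(2,1)])
qed simp

lemma ex_cross_homogeneous_blocks:
  fixes f :: "nat set \<Rightarrow> nat"
  assumes "0 < k" "f \<in> [X]\<^bsup>2\<^esup> \<rightarrow> {..<k}" "admissible k N X"
    and "has_blocks (omega_large (Suc e)) (Suc N) X"
  shows "\<exists>y A. separates N y A \<and> cross_homogeneous f N A \<and>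
    (\<forall>j<N. A j \<subseteq> X \<and> N \<le> y j \<and> admissible k (ramsey_bound k (y j)) (A j) \<and>
      has_blocks (omega_large e) (Suc (ramsey_bound k (y j))) (A j))"
proof -
  have fin: "finite X" and sparse: "sparse double_exp X"
    using assms(3) by (simp_all add: admissible_def)
  obtain y C where sep: "separates N y C" and C_blocks: "\<forall>j<N. y j \<in> X \<and> C j \<subseteq> X \<and>
      has_blocks (omega_large e) (double_exp (y j)) (C j)"
    using ex_separated_multiple_blocks[OF fin sparse assms(4)] by blast
  obtain A where cross: "cross_homogeneous f N A" and A_blocks: "\<forall>j<N. A j \<subseteq> C j \<and>
      has_blocks (omega_large e) (Suc (ramsey_bound k (y j))) (A j)"
    using ex_cross_homogeneous_separated_subblocks[OF assms(1-3) sep C_blocks] by (elim exE conjE)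
  have sep_A: "separates N y A" using separates_subset[OF sep] A_blocks by blast
  have "A j \<subseteq> X \<and> N \<le> y j \<and> admissible k (ramsey_bound k (y j)) (A j)" if "j < N" for j
  proof -
    have "y j \<in> X" "A j \<subseteq> X" using A_blocks C_blocks that by (blast, blast)
    then have low: "15 \<le> y j" "k \<le> y j" "N \<le> y j" using assms(3) by (simp_all add: admissible_def)
    have "admissible k (ramsey_bound k (y j)) (A j)"
    proof (rule admissible_subset[OF assms(3) \<open>A j \<subseteq> X\<close>])
      fix q assume "q \<in> A j"
      then have "q \<in> X" "y j < q"
        using \<open>A j \<subseteq> X\<close> less_setsD[OF separates_less[OF sep_A that]] by auto
      then have "double_exp (y j) \<le> q" using sparseD[OF sparse \<open>y j \<in> X\<close>] by blast
      then show "ramsey_bound k (y j) \<le> q"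
        using ramsey_bound_le_double_exp[OF low(2,1)] by linarith
    qed
    with \<open>A j \<subseteq> X\<close> low(3) show ?thesis by simp
  qed
  then show ?thesis using sep_A cross A_blocks by blast
qed

subsection \<open>Homogeneous sets\<close>

definition joined :: "(nat set \<Rightarrow> 'c) \<Rightarrow> 'c \<Rightarrow> nat set \<Rightarrow> nat set \<Rightarrow> bool" where
  "joined f c A B \<longleftrightarrow> (\<forall>a\<in>A. \<forall>b\<in>B. a < b \<and> f {a, b} = c)"

lemma joined_colour: "joined f c A B \<Longrightarrow> a \<in> A \<Longrightarrow> b \<in> B \<Longrightarrow> f {a, b} = c"
  by (simp add: joined_def)

lemma joined_mono: "joined f c A B \<Longrightarrow> A' \<subseteq> A \<Longrightarrow> B' \<subseteq> B \<Longrightarrow> joined f c A' B'"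
  unfolding joined_def by blast

lemma joined_Un_iff:
  "joined f c (A \<union> A') B \<longleftrightarrow> joined f c A B \<and> joined f c A' B"
  "joined f c A (B \<union> B') \<longleftrightarrow> joined f c A B \<and> joined f c A B'"
  unfolding joined_def by blast+

lemma joined_imp_less_sets: "joined f c A B \<Longrightarrow> A \<lless> B"
  by (simp add: joined_def less_sets_def)

lemma sorted_family_joined_imp_less_sets:
  assumes "sorted_family (joined f c) N G"
  shows "sorted_family (\<lless>) N G"
  by (rule sorted_familyI) (rule joined_imp_less_sets[OF sorted_familyD[OF assms]])

lemma homogeneous_UN_joined:
  fixes G :: "nat \<Rightarrow> nat set"
  assumes hom: "\<forall>t<M. homogeneous f c (G t)" and sorted: "sorted_family (joined f c) M G"
  shows "homogeneous f c (\<Union>t<M. G t)"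
proof -
  have "f {x, y} = c" if "s < M" "t < M" "x \<in> G s" "y \<in> G t" "x \<noteq> y" for s t x y
  proof (cases s t rule: linorder_cases)
    case less
    show ?thesis by (rule joined_colour[OF sorted_familyD[OF sorted less \<open>t < M\<close>] that(3,4)])
  next
    case equal
    then have "homogeneous f c (G t)" "x \<in> G t" using hom that(2,3) by blast+
    then show ?thesis using that(4,5) unfolding homogeneous_iff by blast
  next
    case greater
    have "f {y, x} = c"
      by (rule joined_colour[OF sorted_familyD[OF sorted greater \<open>s < M\<close>] that(4,3)])
    then show ?thesis by (simp add: insert_commute)
  qed
  then show ?thesis unfolding homogeneous_iff by blast
qed

lemma homogeneous_representatives:
  assumes nonempty: "\<forall>t<r. B t \<noteq> {}" and sorted: "sorted_family (joined f c) r B"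
  shows "\<exists>H\<subseteq>\<Union>t<r. B t. homogeneous f c H \<and> has_blocks (omega_large 0) r H"
proof -
  define p where "p t = (SOME q. q \<in> B t)" for t
  have p_in: "p t \<in> B t" if "t < r" for t using nonempty that by (simp add: p_def some_in_eq)
  have sorted_p: "sorted_family (joined f c) r (\<lambda>t. {p t})"
  proof (rule sorted_familyI)
    fix s t assume "s < t" "t < r"
    then show "joined f c {p s} {p t}"
      using joined_mono[OF sorted_familyD[OF sorted]] p_in[of s] p_in[of t] by simp
  qed
  let ?H = "\<Union>t<r. {p t}"
  have "homogeneous f c ?H"
    by (rule homogeneous_UN_joined[OF _ sorted_p]) (simp add: homogeneous_iff)
  moreover have "has_blocks (omega_large 0) r ?H"
    by (rule has_blocksI[OF sorted_family_joined_imp_less_sets[OF sorted_p]]) auto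
  moreover have "?H \<subseteq> (\<Union>t<r. B t)" using p_in by blast
  ultimately show ?thesis by blast
qed

lemma homogeneous_heads:
  assumes sorted: "sorted_family (joined f c) (2 * M) B" and v_in: "\<forall>t<M. v t \<in> B (2 * t)"
    and tails: "\<forall>t<M. H t \<subseteq> B (2 * t + 1) \<and> homogeneous f c (H t) \<and>
      has_blocks (omega_large e) (v t) (H t)"
  shows "\<exists>G\<subseteq>\<Union>t<2 * M. B t. homogeneous f c G \<and> has_blocks (omega_large (Suc e)) M G"
proof -
  define G where "G t = insert (v t) (H t)" for t
  have G_sub: "G t \<subseteq> B (2 * t) \<union> B (2 * t + 1)" if "t < M" for t
    using v_in tails that by (auto simp: G_def)
  have sorted_G: "sorted_family (joined f c) M G"
  proof (rule sorted_familyI)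
    fix s t assume "s < t" "t < M"
    then have "joined f c (B (2 * s) \<union> B (2 * s + 1)) (B (2 * t) \<union> B (2 * t + 1))"
      unfolding joined_Un_iff using sorted_familyD[OF sorted] by simp
    then show "joined f c (G s) (G t)"
      using G_sub \<open>s < t\<close> \<open>t < M\<close> by (simp add: joined_mono)
  qed
  have head: "joined f c {v t} (H t)" if "t < M" for t
    by (rule joined_mono[OF sorted_familyD[OF sorted, of "2 * t" "2 * t + 1"]])
      (use v_in tails that in auto)
  have "\<forall>t<M. homogeneous f c (G t)"
    unfolding G_def using tails head by (auto intro: homogeneous_insert simp: joined_def)
  then have "homogeneous f c (\<Union>t<M. G t)" by (rule homogeneous_UN_joined[OF _ sorted_G])
  moreover have "has_blocks (omega_large (Suc e)) M (\<Union>t<M. G t)"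
  proof (rule has_blocksI[OF sorted_family_joined_imp_less_sets[OF sorted_G]])
    fix t assume "t < M"
    then have "H t \<subseteq> G t \<inter> {v t<..}" using head by (auto simp: G_def joined_def)
    moreover have "has_blocks (omega_large e) (v t) (H t)" using tails \<open>t < M\<close> by blast
    ultimately have "has_blocks (omega_large e) (v t) (G t \<inter> {v t<..})"
      using has_blocks_mono by blast
    then show "omega_large (Suc e) (G t)" by (auto simp: G_def)
  qed auto
  moreover have "(\<Union>t<M. G t) \<subseteq> (\<Union>t<2 * M. B t)"
  proof (rule UN_least)
    fix t assume "t \<in> {..<M}"
    then have t_less: "t < M" "2 * t \<in> {..<2 * M}" "2 * t + 1 \<in> {..<2 * M}" by auto
    show "G t \<subseteq> (\<Union>t<2 * M. B t)"
      by (rule subset_trans[OF G_sub[OF t_less(1)] Un_least]; rule UN_upper; fact t_less)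
  qed
  ultimately show ?thesis by blast
qed

text \<open>Since \<open>m c\<close> has been lowered, a homogeneous set of any colour \<open>d \<noteq> c\<close> is as large as desired;
  sets of colour \<open>c\<close> lack one exponent, which is regained by putting heads in front of them.\<close>

lemma homogeneous_blocks_raise_exponent:
  fixes m :: "nat \<Rightarrow> nat"
  assumes "c < k" "m c = Suc e"
    and sorted: "sorted_family (joined f c) (2 * M) B" and nonempty: "\<forall>t<2 * M. B t \<noteq> {}"
    and rec: "\<forall>t<M. \<exists>y\<ge>M. B (2 * t) \<subseteq> {..y} \<and> (\<exists>d<k. \<exists>H\<subseteq>B (2 * t + 1). homogeneous f d H \<and>
      has_blocks (omega_large ((m(c := e)) d)) y H)"
  shows "\<exists>d<k. \<exists>H\<subseteq>\<Union>t<2 * M. B t. homogeneous f d H \<and> has_blocks (omega_large (m d)) M H"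
proof (cases "\<exists>t<M. \<exists>d<k. \<exists>H\<subseteq>B (2 * t + 1). d \<noteq> c \<and> homogeneous f d H \<and>
    has_blocks (omega_large (m d)) M H")
  case True
  then obtain t d H where "t < M" "d < k" "H \<subseteq> B (2 * t + 1)" "homogeneous f d H"
      "has_blocks (omega_large (m d)) M H"
    by blast
  moreover from this have "H \<subseteq> (\<Union>t<2 * M. B t)" by force
  ultimately show ?thesis by blast
next
  case False
  define v where "v t = (SOME q. q \<in> B (2 * t))" for t
  have v_in: "v t \<in> B (2 * t)" if "t < M" for t using nonempty that by (simp add: v_def some_in_eq)
  have "\<exists>H\<subseteq>B (2 * t + 1). homogeneous f c H \<and> has_blocks (omega_large e) (v t) H"
    if "t < M" for t
  proof -
    obtain y d H where bound: "M \<le> y" "B (2 * t) \<subseteq> {..y}" and "d < k"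
      and recursive: "H \<subseteq> B (2 * t + 1)" "homogeneous f d H"
      and blocks: "has_blocks (omega_large ((m(c := e)) d)) y H"
      using rec \<open>t < M\<close> by blast
    have "d = c"
    proof (rule ccontr)
      assume "d \<noteq> c"
      then have "has_blocks (omega_large (m d)) M H"
        using has_blocks_mono[OF blocks order.refl bound(1)] by simp
      with False \<open>t < M\<close> \<open>d < k\<close> recursive \<open>d \<noteq> c\<close> show False by blast
    qed
    moreover have "v t \<le> y" using bound(2) v_in[OF \<open>t < M\<close>] by blast
    ultimately show ?thesis using recursive has_blocks_mono[OF blocks order.refl] by auto
  qed
  then obtain H where "\<forall>t<M. H t \<subseteq> B (2 * t + 1) \<and> homogeneous f c (H t) \<and>
      has_blocks (omega_large e) (v t) (H t)"
    by (rule choice_lessE) blast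
  then have "\<exists>G\<subseteq>\<Union>t<2 * M. B t. homogeneous f c G \<and> has_blocks (omega_large (Suc e)) M G"
    by (rule homogeneous_heads[OF sorted, rotated]) (simp add: v_in)
  then show ?thesis using assms(1,2) by metis
qed

lemma ex_joined_subsequence:
  fixes f :: "nat set \<Rightarrow> nat"
  assumes "f \<in> [X]\<^bsup>2\<^esup> \<rightarrow> {..<k}" "partn {..<N} r 2 {..<k}" "cross_homogeneous f N A"
    and sorted: "sorted_family (\<lless>) N A" and nonempty_sub: "\<forall>j<N. A j \<subseteq> X \<and> A j \<noteq> {}"
  shows "\<exists>c<k. \<exists>l\<in>{..<r} \<rightarrow> {..<N}. strict_mono_on {..<r} l \<and>
    sorted_family (joined f c) r (\<lambda>t. A (l t))"
proof -
  define p where "p j = (SOME q. q \<in> A j)" for j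
  have p_in: "p j \<in> A j" if "j < N" for j using nonempty_sub that by (simp add: p_def some_in_eq)
  have "strict_mono_on {..<N} p"
  proof (rule strict_mono_onI)
    fix i j assume "i \<in> {..<N}" "j \<in> {..<N}" "i < j"
    then show "p i < p j"
      using less_setsD[OF sorted_familyD[OF sorted, of i j] p_in p_in] by simp
  qed
  then have "inj_on p {..<N}" by (rule strict_mono_on_imp_inj_on)
  moreover have "p \<in> {..<N} \<rightarrow> X" using p_in nonempty_sub by blast
  ultimately have "f \<circ> (\<lambda>e. p ` e) \<in> [{..<N}]\<^bsup>2\<^esup> \<rightarrow> {..<k}"
    using nsets_compose_image_funcset[OF assms(1)] by blast
  then obtain c l where "c < k" and selection: "l \<in> {..<r} \<rightarrow> {..<N}" "strict_mono_on {..<r} l"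
    and colour: "\<And>s t. s < t \<Longrightarrow> t < r \<Longrightarrow> (f \<circ> (\<lambda>e. p ` e)) {l s, l t} = c"
    using partn_strict_monoE[OF assms(2)] by metis
  have "sorted_family (joined f c) r (\<lambda>t. A (l t))"
  proof (rule sorted_familyI)
    fix s t assume st: "s < t" "t < r"
    then have l_less: "l s < l t" "l s < N" "l t < N"
      using selection(1) strict_mono_onD[OF selection(2), of s t] by auto
    have "f {a, b} = c" if "a \<in> A (l s)" "b \<in> A (l t)" for a b
    proof -
      have "f {a, b} = f {p (l s), p (l t)}"
        by (rule cross_homogeneousD[OF assms(3) l_less(1,3)]) (use that p_in l_less in auto)
      then show ?thesis using colour[OF st] by simp
    qed
    with sorted_familyD[OF sorted l_less(1,3)] show "joined f c (A (l s)) (A (l t))"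
      by (simp add: joined_def less_sets_def)
  qed
  then show ?thesis using \<open>c < k\<close> selection by blast
qed

lemma ex_singleton_blocks:
  assumes "has_blocks (omega_large 0) N X"
  shows "\<exists>A. sorted_family (\<lless>) N A \<and> cross_homogeneous f N A \<and> (\<forall>j<N. A j \<subseteq> X \<and> A j \<noteq> {})"
proof -
  obtain G where sorted: "sorted_family (\<lless>) N G" and sub: "\<And>j. j < N \<Longrightarrow> G j \<subseteq> X"
    and large: "\<And>j. j < N \<Longrightarrow> omega_large 0 (G j)"
    using has_blocksE[OF assms] by metis
  define A where "A j = {SOME q. q \<in> G j}" for j
  have A_sub: "A j \<subseteq> G j" if "j < N" for j using large[OF that] by (simp add: A_def some_in_eq)
  have "sorted_family (\<lless>) N A"
  proof (rule sorted_familyI)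
    fix i j assume "i < j" "j < N"
    then show "A i \<lless> A j"
      using less_sets_mono[OF sorted_familyD[OF sorted]] A_sub[of i] A_sub[of j] by simp
  qed
  moreover have "A j \<subseteq> X \<and> A j \<noteq> {}" if "j < N" for j
    using subset_trans[OF A_sub sub] that by (simp add: A_def)
  moreover have "cross_homogeneous f N A" by (simp add: cross_homogeneous_def A_def)
  ultimately show ?thesis by blast
qed

lemma homogeneous_blocks_of_joined_points:
  assumes "c < k" "l \<in> {..<2 * M} \<rightarrow> {..<N}" "m c = 0" "\<forall>j<N. A j \<subseteq> X \<and> A j \<noteq> {}"
    and sorted: "sorted_family (joined f c) (2 * M) (\<lambda>t. A (l t))"
  shows "\<exists>c<k. \<exists>H\<subseteq>X. homogeneous f c H \<and> has_blocks (omega_large (m c)) M H"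
proof -
  have sub: "A (l t) \<subseteq> X" and "A (l t) \<noteq> {}" if "t < 2 * M" for t using assms(2,4) that by auto
  then obtain H where representatives: "H \<subseteq> (\<Union>t<2 * M. A (l t))" "homogeneous f c H"
      "has_blocks (omega_large 0) (2 * M) H"
    using homogeneous_representatives[OF _ sorted] by blast
  have "H \<subseteq> X" using representatives(1) sub by blast
  moreover have "has_blocks (omega_large (m c)) M H"
    unfolding assms(3) by (rule has_blocks_mono[OF representatives(3) order.refl]) simp
  ultimately show ?thesis using assms(1) representatives(2) by blast
qed

lemma homogeneous_blocks_step:
  fixes f :: "nat set \<Rightarrow> nat" and m :: "nat \<Rightarrow> nat"
  assumes "0 < k" "f \<in> [X]\<^bsup>2\<^esup> \<rightarrow> {..<k}" "admissible k N X" "partn {..<N} (2 * M) 2 {..<k}"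
    and "has_blocks (omega_large (Suc e)) (Suc N) X"
    and rec: "\<And>c e' Y y. c < k \<Longrightarrow> m c = Suc e' \<Longrightarrow> Y \<subseteq> X \<Longrightarrow> admissible k (ramsey_bound k y) Y \<Longrightarrow>
      has_blocks (omega_large e) (Suc (ramsey_bound k y)) Y \<Longrightarrow>
      \<exists>d<k. \<exists>H\<subseteq>Y. homogeneous f d H \<and> has_blocks (omega_large ((m(c := e')) d)) y H"
  shows "\<exists>c<k. \<exists>H\<subseteq>X. homogeneous f c H \<and> has_blocks (omega_large (m c)) M H"
proof -
  obtain y A where sep: "separates N y A" and cross: "cross_homogeneous f N A"
    and blocks: "\<forall>j<N. A j \<subseteq> X \<and> N \<le> y j \<and> admissible k (ramsey_bound k (y j)) (A j) \<and>
      has_blocks (omega_large e) (Suc (ramsey_bound k (y j))) (A j)"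
    using ex_cross_homogeneous_blocks[OF assms(1-3,5)] by (elim exE conjE)
  have nonempty_sub: "\<forall>j<N. A j \<subseteq> X \<and> A j \<noteq> {}"
    using blocks has_blocks_omega_large_nonempty by (meson zero_less_Suc)
  obtain c l where "c < k" and selection: "l \<in> {..<2 * M} \<rightarrow> {..<N}" "strict_mono_on {..<2 * M} l"
    and sorted: "sorted_family (joined f c) (2 * M) (\<lambda>t. A (l t))"
    using ex_joined_subsequence
      [OF assms(2,4) cross separates_imp_sorted_family[OF sep] nonempty_sub] by blast
  show ?thesis
  proof (cases "m c")
    case 0
    then show ?thesis
      using \<open>c < k\<close> selection(1) nonempty_sub sorted by (intro homogeneous_blocks_of_joined_points)
  next
    case (Suc e')
    have "\<exists>d<k. \<exists>H\<subseteq>\<Union>t<2 * M. A (l t). homogeneous f d H \<and> has_blocks (omega_large (m d)) M H"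
    proof (rule homogeneous_blocks_raise_exponent
        [where m = m and B = "\<lambda>t. A (l t)", OF \<open>c < k\<close> Suc sorted]; intro allI impI)
      show "A (l t) \<noteq> {}" if "t < 2 * M" for t using nonempty_sub selection(1) that by auto
      fix t assume "t < M"
      define i j where "i = l (2 * t)" and "j = l (2 * t + 1)"
      have "i < j" "j < N"
        using selection(1) strict_mono_onD[OF selection(2), of "2 * t" "2 * t + 1"] \<open>t < M\<close>
        by (auto simp: i_def j_def)
      then have "A i \<subseteq> {..y j}" using separates_past[OF sep \<open>j < N\<close>] by force
      moreover have "2 * M \<le> N"
        using card_inj_on_le[OF strict_mono_on_imp_inj_on[OF selection(2)], of "{..<N}"]
          selection(1) by auto
      moreover have "N \<le> y j" using blocks \<open>j < N\<close> by blast
      moreover have "\<exists>d<k. \<exists>H\<subseteq>A j. homogeneous f d H \<and>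
          has_blocks (omega_large ((m(c := e')) d)) (y j) H"
        by (rule rec[OF \<open>c < k\<close> Suc]) (use blocks \<open>j < N\<close> in blast)+
      ultimately show "\<exists>y\<ge>M. A (l (2 * t)) \<subseteq> {..y} \<and> (\<exists>d<k. \<exists>H\<subseteq>A (l (2 * t + 1)).
          homogeneous f d H \<and> has_blocks (omega_large ((m(c := e')) d)) y H)"
        by (intro exI[of _ "y j"]) (auto simp: i_def j_def)
    qed
    moreover have "(\<Union>t<2 * M. A (l t)) \<subseteq> X" using nonempty_sub selection(1) by blast
    ultimately show ?thesis by (meson subset_trans)
  qed
qed

lemma sum_fun_upd_pred:
  fixes m :: "'a \<Rightarrow> nat"
  assumes "finite C" "c \<in> C" "m c = Suc e"
  shows "Suc (\<Sum>d\<in>C. (m(c := e)) d) = (\<Sum>d\<in>C. m d)"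
proof -
  have "(\<Sum>d\<in>C - {c}. (m(c := e)) d) = (\<Sum>d\<in>C - {c}. m d)" by (intro sum.cong) auto
  then show ?thesis using assms by (simp add: sum.remove)
qed

lemma homogeneous_blocks:
  fixes f :: "nat set \<Rightarrow> nat" and m :: "nat \<Rightarrow> nat"
  assumes "0 < k" "f \<in> [X]\<^bsup>2\<^esup> \<rightarrow> {..<k}" "admissible k N X" "partn {..<N} (2 * M) 2 {..<k}"
    and "has_blocks (omega_large (\<Sum>c<k. m c)) (Suc N) X"
  shows "\<exists>c<k. \<exists>H\<subseteq>X. homogeneous f c H \<and> has_blocks (omega_large (m c)) M H"
  using assms(2-)
proof (induction "\<Sum>c<k. m c" arbitrary: X m N M)
  case 0
  have "has_blocks (omega_large 0) (Suc N) X" using 0(5) unfolding 0(1)[symmetric] .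
  then have "has_blocks (omega_large 0) N X" by (rule has_blocks_mono) simp_all
  from ex_singleton_blocks[OF this, of f] obtain A where sorted: "sorted_family (\<lless>) N A"
    and cross: "cross_homogeneous f N A" and nonempty_sub: "\<forall>j<N. A j \<subseteq> X \<and> A j \<noteq> {}"
    by (elim exE conjE)
  then obtain c l where "c < k" "l \<in> {..<2 * M} \<rightarrow> {..<N}"
      "sorted_family (joined f c) (2 * M) (\<lambda>t. A (l t))"
    using ex_joined_subsequence[OF 0(2,4) cross sorted nonempty_sub] by blast
  moreover from this have "m c = 0" using 0(1) by simp
  ultimately show ?case using nonempty_sub by (intro homogeneous_blocks_of_joined_points)
next
  case (Suc e)
  show ?case
  proof (rule homogeneous_blocks_step[OF assms(1) Suc.prems(1-3)])
    show "has_blocks (omega_large (Suc e)) (Suc N) X" using Suc.prems(4) Suc.hyps(2) by simp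
    fix c e' Y y
    assume colour: "c < k" "m c = Suc e'" and "Y \<subseteq> X" "admissible k (ramsey_bound k y) Y"
      and blocks: "has_blocks (omega_large e) (Suc (ramsey_bound k y)) Y"
    have sum: "e = (\<Sum>d<k. (m(c := e')) d)"
      using sum_fun_upd_pred[of "{..<k}" c m e'] colour Suc.hyps(2) by simp
    show "\<exists>d<k. \<exists>H\<subseteq>Y. homogeneous f d H \<and> has_blocks (omega_large ((m(c := e')) d)) y H"
    proof (rule Suc.hyps(1)[OF sum _ \<open>admissible k (ramsey_bound k y) Y\<close>])
      show "f \<in> [Y]\<^bsup>2\<^esup> \<rightarrow> {..<k}" using Suc.prems(1) nsets_Pi_contra[OF \<open>Y \<subseteq> X\<close>] by blast
      show "partn {..<ramsey_bound k y} (2 * y) 2 {..<k}"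
        unfolding ramsey_bound_def by (rule partn_power[OF assms(1)])
    qed (use blocks sum in simp)
  qed
qed

theorem theorem2:
  fixes n k :: nat and X :: "nat set"
  assumes "n \<ge> 1" and "k \<ge> 1"
    and "finite X"
    and "large (omega_pow (ord_of_nat (k * n + 3))) X"
    and "Min X \<ge> 17"
  shows "RT2_large k (omega_pow (ord_of_nat n)) X"
  unfolding RT2_large_def
proof
  fix f assume colouring: "f \<in> [X]\<^bsup>2\<^esup> \<rightarrow> {..<k}"
  have "omega_large (k * n + 3) X" using assms(4) omega_large_iff by blast
  moreover have "\<forall>x\<in>X. 15 \<le> x" using Min_le[OF assms(3)] assms(5) by force
  moreover have "k \<le> k * n" using assms(1) by simp
  ultimately obtain Y where "Y \<subseteq> X" "admissible k 2 Y" "has_blocks (omega_large (k * n)) 3 Y"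
    using omega_large_imp_admissible_blocks assms(3) by metis
  moreover have "partn {..<2::nat} (2 * 1) 2 {..<k}" using partn_self[of 2] by simp
  moreover have "f \<in> [Y]\<^bsup>2\<^esup> \<rightarrow> {..<k}" using colouring nsets_Pi_contra[OF \<open>Y \<subseteq> X\<close>] by blast
  ultimately obtain c G where "G \<subseteq> Y" "homogeneous f c G" "has_blocks (omega_large n) 1 G"
    using homogeneous_blocks[of k f Y 2 1 "\<lambda>_. n"] assms(2) by auto
  then have "omega_large n G" using omega_large_mono by auto
  then obtain H where "H \<subseteq> G" "large (omega_pow (ord_of_nat n)) H"
    unfolding omega_large_iff by blast
  moreover have "\<forall>e\<in>[H]\<^bsup>2\<^esup>. f e = c"
    using \<open>homogeneous f c G\<close> nsets_mono[OF \<open>H \<subseteq> G\<close>] unfolding homogeneous_def by blast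
  ultimately show "\<exists>H\<subseteq>X. large (omega_pow (ord_of_nat n)) H \<and> (\<exists>c. \<forall>e\<in>[H]\<^bsup>2\<^esup>. f e = c)"
    using \<open>G \<subseteq> Y\<close> \<open>Y \<subseteq> X\<close> by blast
qed

end
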